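(* Let $k$ be a number field. There exists an octonion algebra $\mathfrak C$ over $k$ such that not every semisimple element of $\mathrm{Aut}(\mathfrak C)$ is real, i.e. there is a semisimple element $t\in\mathrm{Aut}(\mathfrak C)$ (the group of $k$-algebra automorphisms) that is not conjugate to $t^{-1}$ in $\mathrm{Aut}(\mathfrak C)$.
   Context: An octonion algebra over $k$ is an $8$-dimensional unital (nonassociative) $k$-algebra $\mathfrak C$ with a nondegenerate quadratic form $N$ satisfying $N(xy)=N(x)N(y)$ for all $x,y$. The automorphism group of $\mathfrak C$ is the group of $k$-points of an algebraic group of type $G_2$; an automorphism is semisimple if it is semisimple as a $k$-linear map on $\mathfrak C$. *)

theory Defs
  imports "HOL-Analysis.Cartesian_Space"
begin

abbreviation rat_scale :: "rat \<Rightarrow> 'k::field_char_0 \<Rightarrow> 'k" where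
  "rat_scale q x \<equiv> of_rat q * x"

lemma vector_space_rat_scale: "vector_space (rat_scale :: rat \<Rightarrow> 'k::field_char_0 \<Rightarrow> 'k)"
  by unfold_locales (auto simp: algebra_simps of_rat_add of_rat_mult)

text \<open>The field is the whole type; finite degree means that it is spanned over
  the rationals by a finite set.\<close>

definition number_field :: "'k::field_char_0 itself \<Rightarrow> bool" where
  "number_field _ \<longleftrightarrow>
     (\<exists>B :: 'k set. finite B \<and> module.span rat_scale B = UNIV)"

definition polar_form :: "('v::ab_group_add \<Rightarrow> 'k::field) \<Rightarrow> 'v \<Rightarrow> 'v \<Rightarrow> 'k" where
  "polar_form N x y = N (x + y) - N x - N y"

definition nondegenerate_quadratic_form ::
  "('k::field \<Rightarrow> 'v::ab_group_add \<Rightarrow> 'v) \<Rightarrow> ('v \<Rightarrow> 'k) \<Rightarrow> bool" where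
  "nondegenerate_quadratic_form smul N \<longleftrightarrow>
     (\<forall>a x. N (smul a x) = a\<^sup>2 * N x) \<and>
     (\<forall>x. Vector_Spaces.linear smul (*) (polar_form N x)) \<and>
     (\<forall>y. Vector_Spaces.linear smul (*) (\<lambda>x. polar_form N x y)) \<and>
     (\<forall>x. (\<forall>y. polar_form N x y = 0) \<longrightarrow> x = 0)"

text \<open>The algebra is the whole type \<^typ>\<open>'v\<close>. The library's dimension of an
  infinite-dimensional space is 0, so the dimension condition includes
  finite-dimensionality.\<close>

locale octonion_algebra = vector_space smul
  for smul :: "'k::field \<Rightarrow> 'v::ab_group_add \<Rightarrow> 'v" +
  fixes mult :: "'v \<Rightarrow> 'v \<Rightarrow> 'v"
    and unit :: 'v
    and N :: "'v \<Rightarrow> 'k"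
  assumes dim_eq_8: "dim (UNIV :: 'v set) = 8"
    and linear_mult_right: "Vector_Spaces.linear smul smul (mult x)"
    and linear_mult_left: "Vector_Spaces.linear smul smul (\<lambda>x. mult x y)"
    and mult_unit_left: "mult unit x = x"
    and mult_unit_right: "mult x unit = x"
    and nondegenerate: "nondegenerate_quadratic_form smul N"
    and norm_mult: "N (mult x y) = N x * N y"

text \<open>Preservation of the unit is automatic for a bijective multiplicative map.
  The group operation on this set is composition.\<close>

definition algebra_Aut ::
  "('k::field \<Rightarrow> 'v::ab_group_add \<Rightarrow> 'v) \<Rightarrow> ('v \<Rightarrow> 'v \<Rightarrow> 'v) \<Rightarrow> ('v \<Rightarrow> 'v) set" where
  "algebra_Aut smul mult =
     {f. Vector_Spaces.linear smul smul f \<and> bij f \<and>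
         (\<forall>x y. f (mult x y) = mult (f x) (f y))}"

definition semisimple_map ::
  "('k::field \<Rightarrow> 'v::ab_group_add \<Rightarrow> 'v) \<Rightarrow> ('v \<Rightarrow> 'v) \<Rightarrow> bool" where
  "semisimple_map smul f \<longleftrightarrow>
     Vector_Spaces.linear smul smul f \<and>
     (\<forall>U. module.subspace smul U \<and> f ` U \<subseteq> U \<longrightarrow>
        (\<exists>W. module.subspace smul W \<and> f ` W \<subseteq> W \<and>
             U \<inter> W = {0} \<and> (\<forall>v. \<exists>u\<in>U. \<exists>w\<in>W. v = u + w)))"

definition conjugate_in :: "('v \<Rightarrow> 'v) set \<Rightarrow> ('v \<Rightarrow> 'v) \<Rightarrow> ('v \<Rightarrow> 'v) \<Rightarrow> bool" where
  "conjugate_in G s t \<longleftrightarrow> (\<exists>g\<in>G. g \<circ> s \<circ> inv g = t)"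

definition real_in :: "('v \<Rightarrow> 'v) set \<Rightarrow> ('v \<Rightarrow> 'v) \<Rightarrow> bool" where
  "real_in G t \<longleftrightarrow> conjugate_in G t (inv t)"

end

theory Submission
  imports Defs
begin

text \<open>The algebra is the split one. A matrix \<open>A \<in> SL\<^sub>3(k)\<close> acts on Zorn's vector matrices by
  \<open>A\<close> on the upper vector and \<open>A\<close>'s inverse transpose on the lower one. If the characteristic
  polynomial of \<open>A\<close> has no root, an automorphism reversing this map permutes the two diagonal
  idempotents, since they span the fixed space together. If it fixes them, \<open>A\<close> is conjugate to its
  inverse, which the characteristic polynomial \<open>X\<^sup>3 + bX - 1\<close> rules out. If it swaps them, \<open>A\<close> is
  conjugate to its transpose by a matrix of determinant \<open>-1\<close>. For the companion matrix conjugated by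
  \<open>diag(d, 1, 1)\<close> the solutions \<open>G\<close> of \<open>G A = A\<^sup>T G\<close> are given by Hankel matrices, with determinant
  \<open>-d\<close> times a norm from the cubic extension, so \<open>d\<close> is a norm, contrary to its choice.

  To find \<open>b\<close> and \<open>d\<close>, take a maximal subring without \<open>1/2\<close>; it is a valuation ring with finite
  residue field. As \<open>r \<mapsto> (1 - r\<^sup>3)/r\<close> maps the nonzero residues to the residues, it misses some \<open>b\<close>,
  so \<open>X\<^sup>3 + bX - 1\<close> has no root modulo the maximal ideal and every norm is a unit times a cube. The
  value group is not 3-divisible, since otherwise \<open>2\<close> would have roots of order \<open>3\<^sup>j\<close> up to units for
  every \<open>j\<close>, of unbounded degree over the rationals.\<close>

subsection \<open>Valuation rings and the cubic norm form\<close>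

locale subring =
  fixes R :: "'a::field set"
  assumes one_mem: "1 \<in> R"
    and diff_mem: "x \<in> R \<Longrightarrow> y \<in> R \<Longrightarrow> x - y \<in> R"
    and mult_mem: "x \<in> R \<Longrightarrow> y \<in> R \<Longrightarrow> x * y \<in> R"
begin

lemma zero_mem: "0 \<in> R"
  using diff_mem[OF one_mem one_mem] by simp

lemma minus_mem: "x \<in> R \<Longrightarrow> - x \<in> R"
  using diff_mem[OF zero_mem] by fastforce

lemma add_mem: "x \<in> R \<Longrightarrow> y \<in> R \<Longrightarrow> x + y \<in> R"
  using diff_mem[OF _ minus_mem] by fastforce

lemma power_mem: "x \<in> R \<Longrightarrow> x ^ n \<in> R"
  by (induction n) (auto intro: one_mem mult_mem)

lemma of_nat_mem: "of_nat n \<in> R"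
  by (induction n) (auto intro: one_mem zero_mem add_mem)

lemma of_int_mem: "of_int n \<in> R"
  by (cases n) (auto intro!: of_nat_mem minus_mem diff_mem one_mem)

lemma sum_mem: "(\<And>i. i \<in> I \<Longrightarrow> f i \<in> R) \<Longrightarrow> sum f I \<in> R"
  by (induction I rule: infinite_finite_induct) (auto intro: zero_mem add_mem)

lemmas ring_mem = one_mem zero_mem minus_mem add_mem diff_mem mult_mem power_mem

end

locale valuation_subring = subring +
  assumes valuation: "x \<notin> R \<Longrightarrow> inverse x \<in> R"
begin

text \<open>The maximal ideal; 0 is listed apart because \<open>inverse 0 = 0\<close> lies in
  \<open>R\<close>. Field elements outside \<open>R\<close> do not belong to it, so a unit of
  \<open>R\<close> is an \<open>x\<close> with both \<open>x \<in> R\<close> and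
  \<open>x \<notin> nonunits\<close>.\<close>

definition nonunits :: "'a set" where
  "nonunits = {x. x = 0 \<or> inverse x \<notin> R}"

lemma nonunits_mem: "x \<in> nonunits \<Longrightarrow> x \<in> R"
  unfolding nonunits_def using valuation zero_mem by blast

lemma one_notin_nonunits: "1 \<notin> nonunits"
  by (simp add: nonunits_def one_mem)

lemma zero_nonunits: "0 \<in> nonunits"
  by (simp add: nonunits_def)

lemma unit_inverse: "x \<notin> nonunits \<Longrightarrow> inverse x \<in> R"
  by (simp add: nonunits_def)

lemma nonunits_mult:
  assumes "x \<in> nonunits" "r \<in> R"
  shows "r * x \<in> nonunits"
proof (rule ccontr)
  assume "r * x \<notin> nonunits"
  then have "r * x \<noteq> 0" "inverse (r * x) \<in> R"
    by (auto simp: nonunits_def)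
  moreover have "r * inverse (r * x) = inverse x"
    using \<open>r * x \<noteq> 0\<close> by (simp add: field_simps)
  ultimately have "inverse x \<in> R" "x \<noteq> 0"
    using mult_mem[OF assms(2), of "inverse (r * x)"] by (metis, auto)
  then show False
    using assms by (auto simp: nonunits_def)
qed

lemma nonunits_mult': "x \<in> nonunits \<Longrightarrow> r \<in> R \<Longrightarrow> x * r \<in> nonunits"
  by (subst mult.commute) (rule nonunits_mult)

lemma nonunits_add_aux:
  assumes "x \<in> nonunits" "y \<in> nonunits" "y \<noteq> 0" "x / y \<in> R"
  shows "x + y \<in> nonunits"
proof -
  have "x + y = (x / y + 1) * y"
    using assms by (simp add: field_simps)
  also have "\<dots> \<in> nonunits"
    using assms by (intro nonunits_mult ring_mem)
  finally show ?thesis .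
qed

text \<open>For nonzero \<open>x\<close> and \<open>y\<close> one of \<open>x / y\<close>,
  \<open>y / x\<close> lies in \<open>R\<close>, so the sum is an element of \<open>R\<close> times
  one of the two nonunits.\<close>

lemma nonunits_add:
  assumes "x \<in> nonunits" "y \<in> nonunits"
  shows "x + y \<in> nonunits"
proof (cases "x = 0 \<or> y = 0")
  case False
  then have "x / y \<in> R \<or> y / x \<in> R"
    using valuation[of "x / y"] by (auto simp: field_simps)
  then show ?thesis
    using nonunits_add_aux[of x y] nonunits_add_aux[of y x] assms False
    by (auto simp: add.commute)
qed (use assms in auto)

lemma nonunits_minus: "x \<in> nonunits \<Longrightarrow> - x \<in> nonunits"
  by (simp add: nonunits_def) (use minus_mem in fastforce)

lemma nonunits_diff: "x \<in> nonunits \<Longrightarrow> y \<in> nonunits \<Longrightarrow> x - y \<in> nonunits"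
  using nonunits_add[OF _ nonunits_minus] by fastforce

lemma nonunits_sum: "(\<And>i. i \<in> I \<Longrightarrow> f i \<in> nonunits) \<Longrightarrow> sum f I \<in> nonunits"
  by (induction I rule: infinite_finite_induct) (auto intro: zero_nonunits nonunits_add)

lemma nonunits_prime: "x * y \<in> nonunits \<Longrightarrow> x \<in> nonunits \<or> y \<in> nonunits"
  by (auto simp: nonunits_def intro: mult_mem)

lemma nonunits_power: "x ^ n \<in> nonunits \<Longrightarrow> x \<in> nonunits"
  by (induction n) (use nonunits_prime one_notin_nonunits in auto)

text \<open>\<open>w\<close> is an entry of least valuation: two entries are compared, then the
  winner with the third.\<close>

lemma obtain_dominant:
  assumes "(x, y, z) \<noteq> (0, 0, 0)"
  obtains w where "w \<noteq> 0" "w \<in> {x, y, z}" "x / w \<in> R" "y / w \<in> R" "z / w \<in> R"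
proof -
  have two: "\<exists>w. w \<noteq> 0 \<and> w \<in> {x, y} \<and> x / w \<in> R \<and> y / w \<in> R"
    if "x \<noteq> 0 \<or> y \<noteq> 0" for x y
  proof (cases "y \<noteq> 0 \<and> x / y \<in> R")
    case True
    then show ?thesis by (intro exI[of _ y]) (auto simp: one_mem)
  next
    case False
    then have "x \<noteq> 0" using that zero_mem by auto
    moreover have "y / x \<in> R"
      using False valuation[of "x / y"] by (cases "y = 0") (auto simp: zero_mem)
    ultimately show ?thesis by (intro exI[of _ x]) (auto simp: one_mem)
  qed
  show thesis
  proof (cases "x = 0 \<and> y = 0")
    case True
    then show thesis using assms that[of z] zero_mem one_mem by auto
  next
    case False
    then obtain w where w: "w \<noteq> 0" "w \<in> {x, y}" "x / w \<in> R" "y / w \<in> R"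
      using two[of x y] by blast
    obtain w' where w': "w' \<noteq> 0" "w' \<in> {w, z}" "w / w' \<in> R" "z / w' \<in> R"
      using two[of w z] w(1) by blast
    have "x / w' = x / w * (w / w')" "y / w' = y / w * (w / w')"
      using w(1) by simp_all
    then have "x / w' \<in> R" "y / w' \<in> R"
      using w w' by (auto simp only: intro!: mult_mem)
    then show thesis using that[of w'] w w' by auto
  qed
qed

end

text \<open>The norm of \<open>x + y\<theta> + z\<theta>\<^sup>2\<close>, where \<open>\<theta>\<^sup>3 + b\<theta> = 1\<close>.\<close>

definition cubic_norm :: "'k::comm_ring_1 \<Rightarrow> 'k \<Rightarrow> 'k \<Rightarrow> 'k \<Rightarrow> 'k" where
  "cubic_norm b x y z =
     x * ((x - b * z)\<^sup>2 - y * (z - b * y)) - z * (y * (x - b * z) - z * (z - b * y))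
       + y * (y\<^sup>2 - z * (x - b * z))"

lemma cubic_norm_scale: "cubic_norm b (w * x) (w * y) (w * z) = w ^ 3 * cubic_norm b x y z"
  unfolding cubic_norm_def by (simp add: algebra_simps power2_eq_square power3_eq_cube)

section \<open>The cubic norm over a valuation ring\<close>

context valuation_subring
begin

lemma cubic_norm_mem:
  "b \<in> R \<Longrightarrow> x \<in> R \<Longrightarrow> y \<in> R \<Longrightarrow> z \<in> R \<Longrightarrow> cubic_norm b x y z \<in> R"
  unfolding cubic_norm_def by (intro ring_mem)

text \<open>This norm is the resultant of X^2 + yX + x and X^3 + bX - 1. If it vanished in the
  residue field, the two polynomials would share a factor there and the cubic would have a
  root.\<close>

lemma cubic_norm_monic_unit:
  assumes b: "b \<in> R" and no_root: "\<forall>r\<in>R. r ^ 3 + b * r - 1 \<notin> nonunits"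
    and "x \<in> R" "y \<in> R"
  shows "cubic_norm b x y 1 \<notin> nonunits"
proof
  assume N: "cubic_norm b x y 1 \<in> nonunits"
  define \<alpha> \<beta> where "\<alpha> = b - x + y\<^sup>2" and "\<beta> = x * y - 1"
  \<comment> \<open>The remainder of \<open>X\<^sup>3 + bX - 1\<close> modulo \<open>X\<^sup>2 + yX + x\<close> is \<open>\<alpha>X + \<beta>\<close>.\<close>
  have mem: "\<alpha> \<in> R" "\<beta> \<in> R"
    unfolding \<alpha>_def \<beta>_def using assms by (auto intro!: ring_mem)
  \<comment> \<open>The right side is the resultant of X^2 + yX + x and the remainder; for a unit
    \<alpha> it is \<alpha>^2 times the value of the quadratic at -\<beta>/\<alpha>.\<close>
  have res: "cubic_norm b x y 1 = \<beta>\<^sup>2 - y * \<alpha> * \<beta> + x * \<alpha>\<^sup>2"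
    unfolding cubic_norm_def \<alpha>_def \<beta>_def by algebra
  show False
  proof (cases "\<alpha> \<in> nonunits")
    case True
    have "\<beta>\<^sup>2 = cubic_norm b x y 1 + (y * \<beta> - x * \<alpha>) * \<alpha>"
      unfolding res by algebra
    also have "\<dots> \<in> nonunits"
      using N True mem assms by (intro nonunits_add nonunits_mult ring_mem)
    finally have "\<beta> \<in> nonunits" by (rule nonunits_power)
    \<comment> \<open>The cofactor in the division is X - y, so \<open>y\<close> is a root wherever
      the remainder vanishes.\<close>
    moreover have "y ^ 3 + b * y - 1 = y * \<alpha> + \<beta>"
      unfolding \<alpha>_def \<beta>_def by algebra
    ultimately show False
      using bspec[OF no_root, of y] nonunits_add nonunits_mult[OF True \<open>y \<in> R\<close>] assms by simp
  next
    case False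
    define i where "i = inverse \<alpha>"
    have "\<alpha> \<noteq> 0" using False zero_nonunits by auto
    then have i: "i * \<alpha> = 1" "i \<in> R"
      using False unit_inverse by (auto simp: i_def)
    \<comment> \<open>The root of the remainder; modulo the maximal ideal it is a root of the
      quadratic too.\<close>
    define r where "r = - \<beta> * i"
    have r: "r \<in> R" unfolding r_def using i mem by (intro ring_mem)
    have "r ^ 3 + b * r - 1 = (r - y) * (r\<^sup>2 + y * r + x) + (\<alpha> * r + \<beta>)"
      unfolding \<alpha>_def \<beta>_def by algebra
    also have "\<alpha> * r + \<beta> = 0"
      using i(1) unfolding r_def by algebra
    also have "r\<^sup>2 + y * r + x = i\<^sup>2 * cubic_norm b x y 1"
      using i(1) unfolding r_def res by algebra
    also have "(r - y) * (i\<^sup>2 * cubic_norm b x y 1) + 0 \<in> nonunits"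
      using N r i assms by (simp, intro nonunits_mult ring_mem)
    finally show False using bspec[OF no_root r] by blast
  qed
qed

text \<open>If \<open>z\<close> is a unit, scaling reduces to the monic case. Otherwise the norm is
  congruent to x^3 + bxy^2 + y^3, which either yields the root -x/y or puts \<open>x\<close> and
  \<open>y\<close> into the maximal ideal as well, against the entry 1.\<close>

lemma cubic_norm_unit:
  assumes b: "b \<in> R" and no_root: "\<forall>r\<in>R. r ^ 3 + b * r - 1 \<notin> nonunits"
    and mem: "x \<in> R" "y \<in> R" "z \<in> R" and one: "1 \<in> {x, y, z}"
  shows "cubic_norm b x y z \<notin> nonunits"
proof
  assume N: "cubic_norm b x y z \<in> nonunits"
  show False
  proof (cases "z \<in> nonunits")
    case True
    have "x ^ 3 + b * x * y\<^sup>2 + y ^ 3 = cubic_norm b x y z + z *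
        (b * x\<^sup>2 + b * x\<^sup>2 - b\<^sup>2 * x * z + x * y + x * y + x * y - b * y * z - z\<^sup>2)"
      unfolding cubic_norm_def by algebra
    also have "\<dots> \<in> nonunits"
      using N True mem b by (intro nonunits_add nonunits_mult' ring_mem)
    finally have *: "x ^ 3 + b * x * y\<^sup>2 + y ^ 3 \<in> nonunits" .
    show False
    proof (cases "y \<in> nonunits")
      case y: True
      have "x ^ 3 = x ^ 3 + b * x * y\<^sup>2 + y ^ 3 - y * (b * x * y + y\<^sup>2)"
        by algebra
      also have "\<dots> \<in> nonunits"
        using * y mem b by (intro nonunits_diff nonunits_mult' ring_mem)
      finally have "x \<in> nonunits" by (rule nonunits_power)
      then show False using one y True one_notin_nonunits by auto
    next
      case False
      define i where "i = inverse y"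
      have "y \<noteq> 0" using False zero_nonunits by auto
      then have i: "i * y = 1" "i \<in> R"
        using False unit_inverse by (auto simp: i_def)
      have "(- x * i) ^ 3 + b * (- x * i) - 1 = (- (i ^ 3)) * (x ^ 3 + b * x * y\<^sup>2 + y ^ 3)"
        using i(1) by algebra
      also have "\<dots> \<in> nonunits"
        using * i by (intro nonunits_mult ring_mem)
      finally show False using bspec[OF no_root, of "- x * i"] mem i by (simp add: ring_mem)
    qed
  next
    case False
    define i where "i = inverse z"
    have "z \<noteq> 0" using False zero_nonunits by auto
    then have i: "i * z = 1" "i \<in> R"
      using False unit_inverse by (auto simp: i_def)
    have "cubic_norm b (i * x) (i * y) 1 = i ^ 3 * cubic_norm b x y z"
      using cubic_norm_scale[of b i x y z] i(1) by simp
    also have "\<dots> \<in> nonunits"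
      using N i by (intro nonunits_mult ring_mem)
    finally show False
      using cubic_norm_monic_unit[OF b no_root, of "i * x" "i * y"] i mem by (simp add: mult_mem)
  qed
qed

text \<open>Dividing by an entry \<open>w\<close> of least valuation leaves a triple whose norm is a
  unit; homogeneity restores the factor w^3.\<close>

lemma cubic_norm_eq_unit_cube:
  assumes b: "b \<in> R" and no_root: "\<forall>r\<in>R. r ^ 3 + b * r - 1 \<notin> nonunits"
    and nz: "(x, y, z) \<noteq> (0, 0, 0)"
  obtains u w where "cubic_norm b x y z = u * w ^ 3" "w \<noteq> 0" "u \<in> R" "u \<notin> nonunits"
proof -
  obtain w where w: "w \<noteq> 0" "w \<in> {x, y, z}" "x / w \<in> R" "y / w \<in> R" "z / w \<in> R"
    by (rule obtain_dominant[OF nz])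
  have "1 \<in> {x / w, y / w, z / w}"
    using w by auto
  then have "cubic_norm b (x / w) (y / w) (z / w) \<notin> nonunits"
    using cubic_norm_unit[OF b no_root] w by simp
  moreover have "cubic_norm b x y z = cubic_norm b (x / w) (y / w) (z / w) * w ^ 3"
    using cubic_norm_scale[of b w "x / w" "y / w" "z / w"] w(1) by simp
  ultimately show thesis
    using that[of "cubic_norm b (x / w) (y / w) (z / w)" w] w by (simp add: cubic_norm_mem b)
qed

text \<open>A root of X^3 + bX - 1 is nonzero in the residue field and determines b there. If every
  b had a root, choosing one would inject the finite residue field into itself, hence map onto it,
  and 0 would be such a root.\<close>

lemma exists_rootless_cubic:
  assumes "finite S" "\<And>r. r \<in> R \<Longrightarrow> \<exists>s\<in>S. r - s \<in> nonunits"
  shows "\<exists>b\<in>R. \<forall>r\<in>R. r ^ 3 + b * r - 1 \<notin> nonunits"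
proof (rule ccontr)
  assume "\<not> ?thesis"
  then have "\<forall>b\<in>R. \<exists>r. r \<in> R \<and> r ^ 3 + b * r - 1 \<in> nonunits"
    by auto
  from bchoice[OF this] obtain \<rho>
    where \<rho>: "\<And>b. b \<in> R \<Longrightarrow> \<rho> b \<in> R \<and> \<rho> b ^ 3 + b * \<rho> b - 1 \<in> nonunits"
    by blast
  define coset where "coset r = {s. r - s \<in> nonunits}" for r
  have coset_eq: "coset r = coset s \<longleftrightarrow> r - s \<in> nonunits" for r s
  proof
    assume "coset r = coset s"
    moreover have "s \<in> coset s" using zero_nonunits by (simp add: coset_def)
    ultimately show "r - s \<in> nonunits" by (auto simp: coset_def)
  next
    assume rs: "r - s \<in> nonunits"
    have "r - t \<in> nonunits \<longleftrightarrow> s - t \<in> nonunits" for t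
      using nonunits_add[OF rs, of "s - t"] nonunits_diff[OF _ rs, of "r - t"] by auto
    then show "coset r = coset s" by (auto simp: coset_def)
  qed
  have "coset ` R \<subseteq> coset ` S"
    using assms(2) coset_eq by (auto simp: image_iff)
  then have fin: "finite (coset ` R)"
    using assms(1) finite_surj by blast
  define rep where "rep = inv_into R coset"
  have rep: "rep B \<in> R" "coset (rep B) = B" if "B \<in> coset ` R" for B
    using that by (auto simp: rep_def inv_into_into f_inv_into_f)
  define F where "F B = coset (\<rho> (rep B))" for B
  have "inj_on F (coset ` R)"
  proof (rule inj_onI)
    fix B B' assume BB': "B \<in> coset ` R" "B' \<in> coset ` R" and "F B = F B'"
    define b b' r r' where "b = rep B" and "b' = rep B'" and "r = \<rho> b" and "r' = \<rho> b'"
    have mem: "b \<in> R" "b' \<in> R" "r \<in> R" "r' \<in> R"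
      and z: "r ^ 3 + b * r - 1 \<in> nonunits" "r' ^ 3 + b' * r' - 1 \<in> nonunits"
      using rep BB' \<rho> by (auto simp: b_def b'_def r_def r'_def)
    have rr: "r - r' \<in> nonunits"
      using \<open>F B = F B'\<close> by (simp add: F_def coset_eq r_def r'_def b_def b'_def)
    \<comment> \<open>The difference of the two root conditions, with \<open>r\<close> and
      \<open>r'\<close> congruent.\<close>
    have "r * (b - b') = (r ^ 3 + b * r - 1) - (r' ^ 3 + b' * r' - 1)
        - (r - r') * (r\<^sup>2 + r * r' + r'\<^sup>2 + b')"
      by algebra
    also have "\<dots> \<in> nonunits"
      using mem by (intro nonunits_diff[OF nonunits_diff[OF z] nonunits_mult'[OF rr]] ring_mem)
    finally have "r \<in> nonunits \<or> b - b' \<in> nonunits"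
      by (rule nonunits_prime)
    moreover have "r \<notin> nonunits"
    proof
      assume "r \<in> nonunits"
      then have "r * (r\<^sup>2 + b) - (r ^ 3 + b * r - 1) \<in> nonunits"
        using mem by (intro nonunits_diff[OF nonunits_mult' z(1)] ring_mem)
      also have "r * (r\<^sup>2 + b) - (r ^ 3 + b * r - 1) = 1" by algebra
      finally show False using one_notin_nonunits by blast
    qed
    ultimately have "coset b = coset b'" by (simp add: coset_eq)
    then show "B = B'" using rep BB' by (simp add: b_def b'_def)
  qed
  moreover have "F ` (coset ` R) \<subseteq> coset ` R"
    using rep \<rho> by (auto simp: F_def)
  ultimately have "F ` (coset ` R) = coset ` R"
    by (intro endo_inj_surj[OF fin])
  then have "coset 0 \<in> F ` (coset ` R)" using zero_mem by simp
  then obtain B where B: "B \<in> coset ` R" "F B = coset 0"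
    by (rule imageE) (rule that, simp_all)
  define b r where "b = rep B" and "r = \<rho> b"
  have r: "b \<in> R" "r \<in> R" "r ^ 3 + b * r - 1 \<in> nonunits" "r \<in> nonunits"
    using B rep \<rho> coset_eq[of r 0] by (auto simp: b_def r_def F_def)
  then have "r * (r\<^sup>2 + b) - (r ^ 3 + b * r - 1) \<in> nonunits"
    by (intro nonunits_diff[OF nonunits_mult' r(3)] ring_mem)
  also have "r * (r\<^sup>2 + b) - (r ^ 3 + b * r - 1) = 1" by algebra
  finally show False using one_notin_nonunits by blast
qed

end

subsection \<open>A valuation ring above 2\<close>

context subring
begin

text \<open>The union over all \<open>n\<close> is the ring R[x]; the degree bound serves the
  descent below.\<close>

definition poly_vals :: "'a \<Rightarrow> nat \<Rightarrow> 'a set" where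
  "poly_vals x n = {\<Sum>i\<le>n. a i * x ^ i |a. \<forall>i. a i \<in> R}"

lemma poly_valsI: "(\<And>i. a i \<in> R) \<Longrightarrow> u = (\<Sum>i\<le>n. a i * x ^ i) \<Longrightarrow> u \<in> poly_vals x n"
  unfolding poly_vals_def by blast

lemma poly_valsE:
  assumes "u \<in> poly_vals x n"
  obtains a where "\<forall>i. a i \<in> R" "u = (\<Sum>i\<le>n. a i * x ^ i)"
proof -
  from assms obtain a where a: "u = (\<Sum>i\<le>n. a i * x ^ i)" "\<forall>i. a i \<in> R"
    unfolding poly_vals_def mem_Collect_eq by (elim exE conjE)
  show thesis
    by (rule that[OF a(2,1)])
qed

lemma poly_vals_add:
  assumes "u \<in> poly_vals x n" "v \<in> poly_vals x n"
  shows "u + v \<in> poly_vals x n"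
proof -
  obtain a where a: "\<forall>i. a i \<in> R" "u = (\<Sum>i\<le>n. a i * x ^ i)"
    using assms(1) by (rule poly_valsE)
  obtain b where b: "\<forall>i. b i \<in> R" "v = (\<Sum>i\<le>n. b i * x ^ i)"
    using assms(2) by (rule poly_valsE)
  show ?thesis
    by (rule poly_valsI[of "\<lambda>i. a i + b i"])
      (simp_all add: a b add_mem sum.distrib distrib_right)
qed

lemma poly_vals_smult:
  assumes "r \<in> R" "u \<in> poly_vals x n"
  shows "r * u \<in> poly_vals x n"
proof -
  obtain a where a: "\<forall>i. a i \<in> R" "u = (\<Sum>i\<le>n. a i * x ^ i)"
    using assms(2) by (rule poly_valsE)
  show ?thesis
    by (rule poly_valsI[of "\<lambda>i. r * a i"])
      (simp_all add: a assms(1) mult_mem sum_distrib_left mult.assoc)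
qed

lemma poly_vals_monom:
  assumes "r \<in> R" "k \<le> n"
  shows "r * x ^ k \<in> poly_vals x n"
proof (rule poly_valsI[of "\<lambda>i. if i = k then r else 0"])
  have "(\<Sum>i\<le>n. (if i = k then r else 0) * x ^ i) = (\<Sum>i\<le>n. if i = k then r * x ^ i else 0)"
    by (intro sum.cong) auto
  also have "\<dots> = r * x ^ k"
    using assms by simp
  finally show "r * x ^ k = (\<Sum>i\<le>n. (if i = k then r else 0) * x ^ i)" ..
qed (use assms zero_mem in auto)

lemma poly_vals_zero: "0 \<in> poly_vals x n"
  using poly_vals_monom[OF zero_mem, of 0 n x] by simp

lemma poly_vals_sum: "(\<And>i. i \<in> I \<Longrightarrow> f i \<in> poly_vals x n) \<Longrightarrow> sum f I \<in> poly_vals x n"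
  by (induction I rule: infinite_finite_induct) (auto intro: poly_vals_zero poly_vals_add)

lemma poly_vals_mono:
  assumes "n \<le> m"
  shows "poly_vals x n \<subseteq> poly_vals x m"
proof
  fix u assume "u \<in> poly_vals x n"
  then obtain a where "\<forall>i. a i \<in> R" "u = (\<Sum>i\<le>n. a i * x ^ i)"
    by (rule poly_valsE)
  with assms show "u \<in> poly_vals x m"
    by (auto intro!: poly_vals_sum poly_vals_monom)
qed

lemma poly_vals_mult:
  assumes "u \<in> poly_vals x n" "v \<in> poly_vals x m"
  shows "u * v \<in> poly_vals x (n + m)"
proof -
  obtain a where a: "\<forall>i. a i \<in> R" "u = (\<Sum>i\<le>n. a i * x ^ i)"
    using assms(1) by (rule poly_valsE)
  obtain b where b: "\<forall>i. b i \<in> R" "v = (\<Sum>i\<le>m. b i * x ^ i)"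
    using assms(2) by (rule poly_valsE)
  have "u * v = (\<Sum>i\<le>n. \<Sum>j\<le>m. (a i * b j) * x ^ (i + j))"
    unfolding a(2) b(2) sum_product by (simp add: power_add mult_ac)
  also have "\<dots> \<in> poly_vals x (n + m)"
    by (intro poly_vals_sum poly_vals_monom mult_mem a(1)[rule_format] b(1)[rule_format]) auto
  finally show ?thesis .
qed

lemma poly_vals_0: "poly_vals x 0 = R"
  using poly_vals_monom[of _ 0 0 x] by (auto simp: poly_vals_def)

lemma subring_poly_vals: "subring (\<Union>n. poly_vals x n)"
proof
  show "1 \<in> (\<Union>n. poly_vals x n)"
    using poly_vals_0 one_mem by blast
next
  fix u v assume "u \<in> (\<Union>n. poly_vals x n)" "v \<in> (\<Union>n. poly_vals x n)"
  then obtain n m where nm: "u \<in> poly_vals x n" "v \<in> poly_vals x m" by blast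
  have "u \<in> poly_vals x (max n m)" "v \<in> poly_vals x (max n m)"
    using nm poly_vals_mono[of n "max n m"] poly_vals_mono[of m "max n m"] by auto
  then have "u + - 1 * v \<in> poly_vals x (max n m)"
    by (intro poly_vals_add poly_vals_smult ring_mem)
  then show "u - v \<in> (\<Union>n. poly_vals x n)" by auto
  show "u * v \<in> (\<Union>n. poly_vals x n)"
    using poly_vals_mult[OF nm] by blast
qed

text \<open>The degree reduction in Chevalley's extension theorem.\<close>

lemma poly_vals_shorten:
  assumes unit: "\<And>r. r \<in> R \<Longrightarrow> 1 - 2 * r \<noteq> 0 \<and> inverse (1 - 2 * r) \<in> R"
    and two: "(2 :: 'a) \<noteq> 0"
    and x: "inverse 2 \<in> poly_vals x (Suc n)" and y: "inverse 2 \<in> poly_vals y m"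
    and xy: "x * y = 1" and mn: "m \<le> Suc n"
  shows "inverse 2 \<in> poly_vals x n"
proof -
  obtain a where a: "\<forall>i. a i \<in> R" "inverse 2 = (\<Sum>i\<le>Suc n. a i * x ^ i)"
    using x by (rule poly_valsE)
  obtain b where b: "\<forall>i. b i \<in> R" "inverse 2 = (\<Sum>j\<le>m. b j * y ^ j)"
    using y by (rule poly_valsE)
  \<comment> \<open>Multiplying 1 = 2 * (b_0 + b_1 y + ...) by x^(n+1) turns y^j into x^(n+1-j).
    Only j = 0 keeps the top power; moving that term to the left gives x^(n+1) the unit coefficient
    \<open>s\<close>.\<close>
  define s where "s = 1 - 2 * b 0"
  have s: "s \<noteq> 0" "inverse s \<in> R"
    using unit[of "b 0"] b by (auto simp: s_def)
  have pow: "y ^ j * x ^ Suc n = x ^ (Suc n - j)" if "j \<le> m" for j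
  proof -
    have "x ^ Suc n = x ^ j * x ^ (Suc n - j)"
      using that mn by (simp flip: power_add)
    then have "y ^ j * x ^ Suc n = (x * y) ^ j * x ^ (Suc n - j)"
      by (simp only: power_mult_distrib mult_ac)
    then show ?thesis using xy by simp
  qed
  have "x ^ Suc n = 2 * inverse 2 * x ^ Suc n"
    using two by simp
  also have "\<dots> = (\<Sum>j\<le>m. 2 * b j * (y ^ j * x ^ Suc n))"
    unfolding b(2) by (simp only: sum_distrib_left sum_distrib_right mult_ac)
  also have "\<dots> = (\<Sum>j\<le>m. 2 * b j * x ^ (Suc n - j))"
    using pow by simp
  also have "\<dots> = 2 * b 0 * x ^ Suc n + (\<Sum>j=1..m. 2 * b j * x ^ (Suc n - j))"
    by (simp add: atMost_atLeast0 sum.atLeast_Suc_atMost)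
  finally have "s * x ^ Suc n = (\<Sum>j=1..m. 2 * b j * x ^ (Suc n - j))"
    by (simp only: s_def left_diff_distrib mult_1_left diff_eq_eq add.commute)
  also have "\<dots> \<in> poly_vals x n"
  proof (intro poly_vals_sum poly_vals_monom)
    fix j assume "j \<in> {1..m}"
    show "2 * b j \<in> R"
      using b(1) of_nat_mem[of 2] by (intro mult_mem) auto
    show "Suc n - j \<le> n"
      using \<open>j \<in> {1..m}\<close> by auto
  qed
  finally have "inverse s * (s * x ^ Suc n) \<in> poly_vals x n"
    using s poly_vals_smult by blast
  then have top: "x ^ Suc n \<in> poly_vals x n"
    using s by (simp flip: mult.assoc)
  have "inverse 2 = (\<Sum>i\<le>n. a i * x ^ i) + a (Suc n) * x ^ Suc n"
    unfolding a(2) by simp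
  also have "\<dots> \<in> poly_vals x n"
    using a(1) top by (intro poly_vals_add poly_vals_sum poly_vals_monom poly_vals_smult) auto
  finally show ?thesis .
qed

text \<open>Descent on \<open>n + m\<close>: the larger degree can always be lowered, until both are
  0 and 1/2 would lie in \<open>R\<close>.\<close>

lemma not_both_poly_vals:
  assumes unit: "\<And>r. r \<in> R \<Longrightarrow> 1 - 2 * r \<noteq> 0 \<and> inverse (1 - 2 * r) \<in> R"
    and two: "(2 :: 'a) \<noteq> 0" "inverse 2 \<notin> R" and xy: "x * y = 1"
  shows "inverse 2 \<notin> poly_vals x n \<or> inverse 2 \<notin> poly_vals y m"
proof (induction "n + m" arbitrary: n m rule: less_induct)
  case less
  have yx: "y * x = 1" using xy by (simp add: mult.commute)
  consider n' where "n = Suc n'" "m \<le> Suc n'" | m' where "m = Suc m'" "n \<le> Suc m'"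
    | "n = 0" "m = 0"
    by (cases n; cases m; cases "m \<le> n") auto
  then show ?case
  proof cases
    case 1
    with less[of n' m] show ?thesis
      using poly_vals_shorten[OF unit two(1) _ _ xy, of n' m] by auto
  next
    case 2
    with less[of n m'] show ?thesis
      using poly_vals_shorten[OF unit two(1) _ _ yx, of m' n] by auto
  qed (use two(2) poly_vals_0 in simp)
qed

end

text \<open>Zorn's lemma gives \<open>R\<close> maximal among the subrings without 1/2. Maximality
  makes every 1 - 2r a unit and puts 1/2 into R[x] for each x outside \<open>R\<close>, so x and its
  inverse cannot both be outside.\<close>

lemma exists_valuation_subring_half:
  "\<exists>R :: 'k::field_char_0 set. valuation_subring R \<and> inverse 2 \<notin> R"
proof -
  define \<A> where "\<A> = {R :: 'k set. subring R \<and> inverse 2 \<notin> R}"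
  have "inverse 2 \<notin> (\<int> :: 'k set)"
  proof
    assume "inverse 2 \<in> (\<int> :: 'k set)"
    then obtain z where z: "inverse 2 = (of_int z :: 'k)" by (rule Ints_cases)
    then have "(of_int (2 * z) :: 'k) = of_int 1"
      by (simp flip: z)
    then have "2 * z = 1" by (simp only: of_int_eq_iff)
    then show False by presburger
  qed
  then have "\<int> \<in> \<A>"
    unfolding \<A>_def by (simp add: subring_def)
  then have "\<A> \<noteq> {}" by blast
  moreover have "\<Union>\<C> \<in> \<A>" if "\<C> \<noteq> {}" "subset.chain \<A> \<C>" for \<C>
  proof -
    have mem: "subring R" "inverse 2 \<notin> R" if "R \<in> \<C>" for R
      using that \<open>subset.chain \<A> \<C>\<close> by (auto simp: subset_chain_def \<A>_def)
    have common: "\<exists>R\<in>\<C>. x \<in> R \<and> y \<in> R" if xy: "x \<in> \<Union>\<C>" "y \<in> \<Union>\<C>" for x y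
    proof -
      obtain R S where RS: "R \<in> \<C>" "S \<in> \<C>" "x \<in> R" "y \<in> S" using xy by blast
      then have "R \<subseteq> S \<or> S \<subseteq> R"
        using \<open>subset.chain \<A> \<C>\<close> by (auto simp: subset_chain_def)
      then show ?thesis using RS by blast
    qed
    have "subring (\<Union>\<C>)"
    proof
      show "1 \<in> \<Union>\<C>"
        using \<open>\<C> \<noteq> {}\<close> mem subring.one_mem by blast
    next
      fix x y assume "x \<in> \<Union>\<C>" "y \<in> \<Union>\<C>"
      then obtain R where R: "R \<in> \<C>" "x \<in> R" "y \<in> R" using common by blast
      then show "x - y \<in> \<Union>\<C>" "x * y \<in> \<Union>\<C>"
        using subring.diff_mem[OF mem(1)] subring.mult_mem[OF mem(1)] by blast+
    qed
    then show ?thesis using mem(2) by (auto simp: \<A>_def)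
  qed
  ultimately obtain R where R: "R \<in> \<A>" and max: "\<And>S. S \<in> \<A> \<Longrightarrow> R \<subseteq> S \<Longrightarrow> S = R"
    using subset_Zorn_nonempty[of \<A>] by blast
  have half: "inverse 2 \<notin> R" using R by (simp add: \<A>_def)
  interpret subring R using R by (simp add: \<A>_def)
  have unit: "1 - 2 * r \<noteq> 0 \<and> inverse (1 - 2 * r) \<in> R" if r: "r \<in> R" for r
  proof
    define s where "s = 1 - 2 * r"
    have s: "s \<in> R"
      using r of_nat_mem[of 2] unfolding s_def by (intro ring_mem) auto
    show nz: "1 - 2 * r \<noteq> 0"
    proof
      assume "1 - 2 * r = 0"
      then have "2 * r = 1" by simp
      then have "inverse 2 = r" by (rule inverse_unique)
      then show False using half r by metis
    qed
    \<comment> \<open>The localisation R[1/s].\<close>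
    define S where "S = {a * inverse s ^ j |a j. a \<in> R}"
    have S: "a * inverse s ^ j \<in> S" if "a \<in> R" for a j
      unfolding S_def using that by blast
    have "subring S"
    proof
      show "1 \<in> S"
        using S[OF one_mem, of 0] by simp
    next
      fix x y assume "x \<in> S" "y \<in> S"
      then obtain a j b l where xy: "x = a * inverse s ^ j" "y = b * inverse s ^ l" "a \<in> R" "b \<in> R"
        unfolding S_def by blast
      have "x - y = (a * s ^ l - b * s ^ j) * inverse s ^ (j + l)"
        using nz unfolding xy s_def[symmetric] by (simp add: field_simps power_add)
      moreover have "a * s ^ l - b * s ^ j \<in> R"
        using xy s by (intro ring_mem)
      ultimately show "x - y \<in> S" by (simp only: S)
      have "x * y = (a * b) * inverse s ^ (j + l)"
        unfolding xy by (simp add: power_add mult_ac)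
      also have "\<dots> \<in> S" using S mult_mem xy by simp
      finally show "x * y \<in> S" .
    qed
    moreover have "inverse 2 \<notin> S"
    proof
      assume "inverse 2 \<in> S"
      then obtain a j where a: "a \<in> R" "inverse 2 = a * inverse s ^ j"
        unfolding S_def by blast
      then have aj: "s ^ j = 2 * a"
        using nz unfolding s_def[symmetric] by (simp add: field_simps)
      \<comment> \<open>Powers of \<open>s\<close> stay congruent to 1 modulo 2R, so 1/2 in
        \<open>S\<close> would put 1 into 2R.\<close>
      have "\<exists>c\<in>R. s ^ j = 1 - 2 * c"
      proof (induction j)
        case 0
        show ?case using zero_mem by auto
      next
        case (Suc j)
        then obtain c where c: "c \<in> R" "s ^ j = 1 - 2 * c" by blast
        have "s ^ Suc j = 1 - 2 * (r + s * c)"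
          unfolding power_Suc c(2) by (simp add: s_def algebra_simps)
        moreover have "r + s * c \<in> R" using r s c(1) by (intro ring_mem)
        ultimately show ?case by blast
      qed
      then obtain c where c: "c \<in> R" "s ^ j = 1 - 2 * c" by blast
      then have "2 * (a + c) = 1" using aj by (simp add: algebra_simps)
      then have "inverse 2 = a + c" by (rule inverse_unique)
      then show False using half add_mem[OF a(1) c(1)] by metis
    qed
    moreover have "R \<subseteq> S"
      using S[of _ 0] by auto
    ultimately have "S = R" using max by (simp add: \<A>_def)
    moreover have "inverse s \<in> S"
      using S[OF one_mem, of 1] by simp
    ultimately show "inverse (1 - 2 * r) \<in> R" by (simp add: s_def)
  qed
  have gen: "\<exists>n. inverse 2 \<in> poly_vals x n" if "x \<notin> R" for x
  proof (rule ccontr)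
    assume "\<nexists>n. inverse 2 \<in> poly_vals x n"
    then have "(\<Union>n. poly_vals x n) \<in> \<A>"
      using subring_poly_vals by (auto simp: \<A>_def)
    moreover have "R \<subseteq> (\<Union>n. poly_vals x n)"
      using poly_vals_0 by blast
    ultimately have "(\<Union>n. poly_vals x n) = R" by (rule max)
    moreover have "x \<in> poly_vals x 1"
      using poly_vals_monom[OF one_mem, of 1 1 x] by simp
    ultimately show False using that by blast
  qed
  have "valuation_subring R"
  proof
    fix x assume x: "x \<notin> R"
    show "inverse x \<in> R"
    proof (rule ccontr)
      assume ix: "inverse x \<notin> R"
      have "x \<noteq> 0" using x zero_mem by metis
      then have xy: "x * inverse x = 1" by simp
      obtain n m where "inverse 2 \<in> poly_vals x n" "inverse 2 \<in> poly_vals (inverse x) m"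
        using gen[OF x] gen[OF ix] by blast
      moreover have "(2 :: 'k) \<noteq> 0" by simp
      ultimately show False
        using not_both_poly_vals[OF unit _ half xy, of n m] by blast
    qed
  qed
  then show ?thesis using half by blast
qed

subsection \<open>Dyadic valuations of number fields\<close>

lemma common_denominator:
  fixes u :: "'a \<Rightarrow> rat"
  assumes "finite S"
  shows "\<exists>D>0. \<forall>s\<in>S. \<exists>c. of_int D * u s = of_int c"
  using assms
proof (induction S rule: finite_induct)
  case empty
  show ?case by (auto intro: exI[of _ 1])
next
  case (insert x S)
  then obtain D where D: "D > 0" "\<forall>s\<in>S. \<exists>c. of_int D * u s = of_int c" by blast
  obtain p q where pq: "quotient_of (u x) = (p, q)" by fastforce
  have q: "q > 0" "u x = of_int p / of_int q"
    using quotient_of_denom_pos[OF pq] quotient_of_div[OF pq] by auto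
  have "of_int (D * q) * u x = of_int (D * p)"
    using q by simp
  moreover have "\<exists>c. of_int (D * q) * u s = of_int c" if s: "s \<in> S" for s
  proof -
    obtain c where c: "of_int D * u s = of_int c" using D(2) s by blast
    have "of_int (D * q) * u s = of_int q * (of_int D * u s)" by simp
    also have "\<dots> = of_int (q * c)" unfolding c by simp
    finally show ?thesis by blast
  qed
  moreover have "D * q > 0" using D q by simp
  ultimately show ?case by blast
qed

text \<open>A relation with only even coefficients can be halved, which lowers the sum of their
  absolute values.\<close>

lemma integer_relation_odd:
  fixes S :: "'k::field_char_0 set"
  assumes "finite S" "(\<Sum>s\<in>S. of_int (c s) * s) = 0" "s \<in> S" "c s \<noteq> 0"
  shows "\<exists>c. (\<Sum>s\<in>S. of_int (c s) * s) = 0 \<and> (\<exists>s\<in>S. odd (c s))"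
  using assms
proof (induction "\<Sum>s\<in>S. nat \<bar>c s\<bar>" arbitrary: c rule: less_induct)
  case less
  show ?case
  proof (cases "\<exists>s\<in>S. odd (c s)")
    case False
    define c' where "c' t = c t div 2" for t
    have c': "c t = 2 * c' t" if "t \<in> S" for t
      using False that by (simp add: c'_def)
    have "2 * (\<Sum>t\<in>S. of_int (c' t) * t) = (\<Sum>t\<in>S. of_int (c t) * t)"
      unfolding sum_distrib_left by (intro sum.cong) (auto simp: c')
    then have "(\<Sum>t\<in>S. of_int (c' t) * t) = 0" using less.prems by simp
    moreover have "c' s \<noteq> 0" using c' less.prems by auto
    moreover have "(\<Sum>t\<in>S. nat \<bar>c' t\<bar>) < (\<Sum>t\<in>S. nat \<bar>c t\<bar>)"
    proof (rule sum_strict_mono_ex1)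
      show "\<forall>t\<in>S. nat \<bar>c' t\<bar> \<le> nat \<bar>c t\<bar>" using c' by auto
      show "\<exists>t\<in>S. nat \<bar>c' t\<bar> < nat \<bar>c t\<bar>"
        using c'[OF less.prems(3)] less.prems(3,4) by (intro bexI[of _ s]) auto
    qed (use less.prems in simp)
    ultimately show ?thesis using less.hyps[of c'] less.prems by blast
  qed (use less.prems in blast)
qed

text \<open>More than \<open>card B\<close> elements are dependent over the rationals. Clearing
  denominators and common factors 2 leaves a relation that is nontrivial modulo 2.\<close>

lemma exists_odd_integer_relation:
  fixes S B :: "'k::field_char_0 set"
  assumes B: "finite B" "module.span rat_scale B = UNIV"
    and S: "finite S" "card B < card S"
  shows "\<exists>c. (\<Sum>s\<in>S. of_int (c s) * s) = 0 \<and> (\<exists>s\<in>S. odd (c s))"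
proof -
  interpret Q: vector_space "rat_scale :: rat \<Rightarrow> 'k \<Rightarrow> 'k"
    by (rule vector_space_rat_scale)
  have "Q.dependent S"
  proof (rule ccontr)
    assume "\<not> Q.dependent S"
    then have "card S \<le> card B"
      using Q.independent_span_bound[OF B(1), of S] B(2) by simp
    then show False using S by simp
  qed
  then obtain u s where u: "s \<in> S" "u s \<noteq> 0" "(\<Sum>v\<in>S. of_rat (u v) * v) = 0"
    using Q.dependent_finite[OF S(1)] by auto
  obtain D where D: "D > 0" "\<forall>s\<in>S. \<exists>c. of_int D * u s = of_int c"
    using common_denominator[OF S(1)] by blast
  obtain c where c: "\<forall>s\<in>S. of_int D * u s = of_int (c s)"
    using bchoice[OF D(2)] by blast
  have "(\<Sum>v\<in>S. of_int (c v) * v) = (\<Sum>v\<in>S. of_int D * (of_rat (u v) * v))"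
  proof (rule sum.cong)
    fix v assume "v \<in> S"
    then have "(of_int (c v) :: 'k) = of_rat (of_int D * u v)" using c by simp
    then show "of_int (c v) * v = of_int D * (of_rat (u v) * v)"
      by (simp add: of_rat_mult)
  qed simp
  also have "\<dots> = 0" using u by (simp flip: sum_distrib_left)
  finally have "(\<Sum>v\<in>S. of_int (c v) * v) = 0" .
  moreover have "c s \<noteq> 0" using c u(1,2) D(1) by fastforce
  ultimately show ?thesis using integer_relation_odd[OF S(1)] u(1) by blast
qed

text \<open>\<open>B\<close> spans the field over the rationals, so \<open>card B\<close> bounds the
  degree.\<close>

locale dyadic_valuation = valuation_subring R for R :: "'k::field_char_0 set" +
  fixes B :: "'k set"
  assumes half: "inverse 2 \<notin> R"
    and finite_basis: "finite B" "module.span rat_scale B = UNIV"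
begin

lemma two_nonunit: "2 \<in> nonunits"
  unfolding nonunits_def using half by blast

lemma even_nonunit:
  assumes "even c"
  shows "(of_int c :: 'k) \<in> nonunits"
proof -
  obtain l where "c = 2 * l" using assms by (elim evenE)
  then have "(of_int c :: 'k) = of_int l * 2" by simp
  also have "\<dots> \<in> nonunits" by (intro nonunits_mult two_nonunit of_int_mem)
  finally show ?thesis .
qed

lemma odd_unit:
  assumes "odd c"
  shows "(of_int c :: 'k) \<notin> nonunits"
proof
  assume "(of_int c :: 'k) \<in> nonunits"
  moreover have "(of_int (c - 1) :: 'k) \<in> nonunits"
    using assms by (intro even_nonunit) simp
  ultimately have "(of_int c - of_int (c - 1) :: 'k) \<in> nonunits" by (rule nonunits_diff)
  then show False using one_notin_nonunits by simp
qed

text \<open>Lifts of vectors that are independent over the two-element field remain independent over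
  the rationals, so the residue field has at most \<open>2 ^ card B\<close> elements.\<close>

lemma finite_residues: "\<exists>T. finite T \<and> (\<forall>r\<in>R. \<exists>s\<in>T. r - s \<in> nonunits)"
proof -
  \<comment> \<open>Independence of the residues over the two-element field: with scalars 0 and 1,
    the nonempty subset sums are all the nontrivial combinations.\<close>
  define indep where "indep S \<longleftrightarrow> finite S \<and> S \<subseteq> R \<and> (\<forall>S'\<subseteq>S. S' \<noteq> {} \<longrightarrow> \<Sum>S' \<notin> nonunits)"
    for S
  have bound: "card S \<le> card B" if "indep S" for S
  proof (rule ccontr)
    assume "\<not> card S \<le> card B"
    then obtain c where c: "(\<Sum>s\<in>S. of_int (c s) * s) = 0" "\<exists>s\<in>S. odd (c s)"
      using exists_odd_integer_relation[OF finite_basis, of S] \<open>indep S\<close>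
      by (auto simp: indep_def)
    \<comment> \<open>Modulo the maximal ideal even coefficients vanish and odd ones become 1, so
      the relation reduces to the sum of \<open>S'\<close>.\<close>
    define S' where "S' = {s \<in> S. odd (c s)}"
    have "\<Sum>S' = (\<Sum>s\<in>S. if odd (c s) then s else 0)"
      using \<open>indep S\<close> by (simp add: S'_def indep_def sum.inter_filter)
    also have "\<dots> = (\<Sum>s\<in>S. of_int ((if odd (c s) then 1 else 0) - c s) * s) + (\<Sum>s\<in>S. of_int (c s) * s)"
      unfolding sum.distrib[symmetric] by (intro sum.cong) (auto simp: algebra_simps)
    also have "\<dots> \<in> nonunits"
      unfolding c(1) add_0_right
    proof (intro nonunits_sum nonunits_mult' even_nonunit)
      fix s assume "s \<in> S"
      then show "s \<in> R" using \<open>indep S\<close> by (auto simp: indep_def)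
      show "even ((if odd (c s) then 1 else 0) - c s)" by simp
    qed
    finally have "\<Sum>S' \<in> nonunits" .
    moreover have "S' \<subseteq> S" "S' \<noteq> {}" using c(2) by (auto simp: S'_def)
    ultimately show False using \<open>indep S\<close> by (simp add: indep_def)
  qed
  have "indep {}" by (simp add: indep_def)
  \<comment> \<open>The subset sums of a largest independent set represent all residues.\<close>
  then have "\<exists>S. indep S \<and> (\<forall>S'. indep S' \<longrightarrow> card S' \<le> card S)"
    using bound by (intro ex_has_greatest_nat[of indep "{}" card "Suc (card B)"])
      (auto simp: less_Suc_eq_le)
  then obtain S where S: "indep S" "\<And>S'. indep S' \<Longrightarrow> card S' \<le> card S" by blast
  have fin: "finite S" and SR: "S \<subseteq> R" using S(1) by (auto simp: indep_def)
  have "\<exists>s \<in> sum id ` Pow S. r - s \<in> nonunits" if r: "r \<in> R" for r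
  proof (cases "r \<in> S")
    case True
    then have "sum id {r} \<in> sum id ` Pow S" by blast
    then show ?thesis using zero_nonunits by (intro bexI[of _ "sum id {r}"]) simp_all
  next
    case False
    then have "card (insert r S) > card S" using fin by simp
    then have "\<not> indep (insert r S)" using S(2)[of "insert r S"] by auto
    then obtain S' where S': "S' \<subseteq> insert r S" "S' \<noteq> {}" "\<Sum>S' \<in> nonunits"
      using fin SR r by (auto simp: indep_def)
    have "r \<in> S'"
    proof (rule ccontr)
      assume "r \<notin> S'"
      then have "S' \<subseteq> S" using S' by blast
      then show False using S' S(1) by (auto simp: indep_def)
    qed
    define P where "P = S' - {r}"
    have P: "P \<subseteq> S" "finite P" using S' fin by (auto simp: P_def intro: finite_subset)
    have "\<Sum>S' = r + sum id P"
      using \<open>r \<in> S'\<close> P by (subst sum.remove[of S' r]) (auto simp: P_def)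
    \<comment> \<open>The sign is immaterial because 2 is a nonunit.\<close>
    then have "r - sum id P = \<Sum>S' - 2 * sum id P"
      by simp
    also have "\<dots> \<in> nonunits"
      using P SR S' by (intro nonunits_diff nonunits_mult' two_nonunit sum_mem) auto
    finally show ?thesis using P by (intro bexI[of _ "sum id P"]) auto
  qed
  then show ?thesis using fin by (intro exI[of _ "sum id ` Pow S"]) simp
qed

text \<open>The powers \<open>y ^ i\<close>, \<open>i < M\<close>, lie in distinct classes of the value group modulo the
  values of the rationals, so they are linearly independent.\<close>

lemma radical_of_two_bound:
  assumes y: "y ^ M = 2 * u" and u: "u \<in> R" "u \<notin> nonunits"
  shows "M \<le> card B"
proof (rule ccontr)
  assume M: "\<not> M \<le> card B"
  have "y ^ M \<in> nonunits"
    unfolding y by (intro nonunits_mult' two_nonunit u)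
  then have yn: "y \<in> nonunits" by (rule nonunits_power)
  have "u \<noteq> 0" using u zero_nonunits by metis
  then have "y ^ M \<noteq> 0" using y by simp
  then have y0: "y \<noteq> 0" using M by (cases "y = 0") (auto simp: power_0_left)
  have pow: "y ^ k \<in> nonunits" if k: "k > 0" for k
  proof -
    obtain l where "k = Suc l" using k by (cases k) auto
    then show ?thesis
      using nonunits_mult'[OF yn power_mem[OF nonunits_mem[OF yn]], of l] by simp
  qed
  have "y ^ i \<noteq> y ^ j" if ij: "i < j" for i j
  proof
    assume "y ^ i = y ^ j"
    also have "\<dots> = y ^ i * y ^ (j - i)" using ij by (simp flip: power_add)
    finally have "y ^ (j - i) = 1" using y0 by simp
    then show False using pow[of "j - i"] ij one_notin_nonunits by simp
  qed
  then have inj: "inj_on (\<lambda>i. y ^ i) {..<M}"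
    by (intro linorder_inj_onI) auto
  define S where "S = (\<lambda>i. y ^ i) ` {..<M}"
  have "card S = M" using inj by (simp add: S_def card_image)
  then obtain c where c: "(\<Sum>s\<in>S. of_int (c s) * s) = 0" "\<exists>s\<in>S. odd (c s)"
    using exists_odd_integer_relation[OF finite_basis, of S] M by (auto simp: S_def)
  define a where "a i = c (y ^ i)" for i
  have rel: "(\<Sum>i<M. of_int (a i) * y ^ i) = 0"
    using c(1) inj by (simp add: S_def sum.reindex a_def)
  \<comment> \<open>The index of the term of least valuation. Later terms have a higher power of
    \<open>y\<close>; an earlier term has an even coefficient, and 2 is y^M up to a unit, which
    lifts its exponent to at least M + i > i0.\<close>
  define i0 where "i0 = (LEAST i. i < M \<and> odd (a i))"
  have "\<exists>i. i < M \<and> odd (a i)" using c(2) by (auto simp: S_def a_def)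
  then have i0: "i0 < M" "odd (a i0)"
    unfolding i0_def by (metis (mono_tags, lifting) LeastI)+
  have least: "even (a i)" if "i < i0" for i
    using not_less_Least[of i "\<lambda>i. i < M \<and> odd (a i)"] that i0(1) by (auto simp: i0_def)
  define f where "f i = of_int (a i) * y ^ i * inverse (y ^ i0)" for i
  have f: "f i \<in> nonunits" if i: "i \<noteq> i0" "i < M" for i
  proof (cases "i < i0")
    case True
    then obtain l where l: "a i = 2 * l" using least by (metis evenE)
    have two: "2 = y ^ M * inverse u" using y \<open>u \<noteq> 0\<close> by simp
    have "y ^ M * y ^ i = y ^ (M + i - i0) * y ^ i0"
      using i0 by (simp flip: power_add)
    then have "f i = (of_int l * inverse u) * y ^ (M + i - i0)"
      using y0 by (simp add: f_def l two field_simps)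
    also have "\<dots> \<in> nonunits"
      using i0(1) u by (intro nonunits_mult pow mult_mem of_int_mem unit_inverse) auto
    finally show ?thesis .
  next
    case False
    have "y ^ i = y ^ (i - i0) * y ^ i0"
      using False by (simp flip: power_add)
    then have "f i = of_int (a i) * y ^ (i - i0)"
      using y0 by (simp add: f_def)
    also have "\<dots> \<in> nonunits"
      using i False by (intro nonunits_mult pow of_int_mem) auto
    finally show ?thesis .
  qed
  \<comment> \<open>After division by y^i0 every other term is a nonunit, so the odd integer
    \<open>a i0\<close> would be one as well.\<close>
  have "(\<Sum>i<M. f i) = 0"
    using rel by (simp add: f_def flip: sum_distrib_right)
  moreover have "(\<Sum>i<M. f i) = f i0 + (\<Sum>i\<in>{..<M} - {i0}. f i)"
    using i0 by (intro sum.remove) auto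
  ultimately have "f i0 = - (\<Sum>i\<in>{..<M} - {i0}. f i)"
    by (simp add: eq_neg_iff_add_eq_0)
  also have "\<dots> \<in> nonunits"
    using f by (intro nonunits_minus nonunits_sum) auto
  finally have "f i0 \<in> nonunits" .
  moreover have "f i0 = of_int (a i0)" using y0 by (simp add: f_def)
  ultimately show False using odd_unit[OF i0(2)] by simp
qed

text \<open>Otherwise decomposing \<open>w\<close> again and again writes 2 as a unit times a power
  with exponent 3^j for every j, and \<open>radical_of_two_bound\<close> fails once 3^j exceeds
  \<open>card B\<close>.\<close>

lemma exists_non_unit_cube:
  "\<exists>d. d \<noteq> 0 \<and> (\<forall>u w. u \<in> R \<longrightarrow> u \<notin> nonunits \<longrightarrow> d \<noteq> u * w ^ 3)"
proof (rule ccontr)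
  assume "\<not> ?thesis"
  then have cube: "\<exists>u w. u \<in> R \<and> u \<notin> nonunits \<and> d = u * w ^ 3" if "d \<noteq> 0" for d
    using that by blast
  have "\<exists>u w. u \<in> R \<and> u \<notin> nonunits \<and> 2 = u * w ^ (3 ^ j)" for j :: nat
  proof (induction j)
    case 0
    show ?case
      using one_mem one_notin_nonunits by (intro exI[of _ 1] exI[of _ 2]) simp
  next
    case (Suc j)
    then obtain u w where uw: "u \<in> R" "u \<notin> nonunits" "2 = u * w ^ (3 ^ j)" by blast
    have "w \<noteq> 0"
    proof
      assume "w = 0"
      with uw(3) show False by (simp add: power_0_left)
    qed
    then obtain u' w' where uw': "u' \<in> R" "u' \<notin> nonunits" "w = u' * w' ^ 3"
      using cube by blast
    have "2 = (u * u' ^ (3 ^ j)) * w' ^ (3 ^ Suc j)"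
      unfolding uw(3) uw'(3) by (simp add: power_mult_distrib mult_ac flip: power_mult)
    moreover have "u * u' ^ (3 ^ j) \<in> R"
      using uw uw' by (intro ring_mem)
    moreover have "u * u' ^ (3 ^ j) \<notin> nonunits"
      using nonunits_prime nonunits_power uw(2) uw'(2) by blast
    ultimately show ?case by blast
  qed
  then obtain u w where uw: "u \<in> R" "u \<notin> nonunits" "2 = u * w ^ (3 ^ Suc (card B))" by blast
  have "u \<noteq> 0" using uw(2) zero_nonunits by metis
  have "w ^ (3 ^ Suc (card B)) = 2 * inverse u"
    unfolding uw(3) using \<open>u \<noteq> 0\<close> by simp
  moreover have "inverse u \<in> R" using uw unit_inverse by blast
  moreover have "inverse u \<notin> nonunits"
    using uw \<open>u \<noteq> 0\<close> by (simp add: nonunits_def)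
  ultimately have "3 ^ Suc (card B) \<le> card B" by (rule radical_of_two_bound)
  moreover have "n < 3 ^ n" for n :: nat by (rule power_gt_expt) simp
  ultimately show False using \<open>\<And>n. n < 3 ^ n\<close>[of "Suc (card B)"] by linarith
qed

lemma exists_cubic_norm:
  "\<exists>b d :: 'k. b \<noteq> 0 \<and> d \<noteq> 0 \<and> (\<forall>x y z. cubic_norm b x y z = 0 \<longrightarrow> x = 0 \<and> y = 0 \<and> z = 0)
     \<and> (\<forall>x y z. d * cubic_norm b x y z \<noteq> 1)"
proof -
  obtain T where "finite T" "\<forall>r\<in>R. \<exists>s\<in>T. r - s \<in> nonunits"
    using finite_residues by blast
  then obtain b where b: "b \<in> R" "\<forall>r\<in>R. r ^ 3 + b * r - 1 \<notin> nonunits"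
    using exists_rootless_cubic[of T] by blast
  obtain d where d: "d \<noteq> 0" "\<forall>u w. u \<in> R \<longrightarrow> u \<notin> nonunits \<longrightarrow> d \<noteq> u * w ^ 3"
    using exists_non_unit_cube by blast
  have "b \<noteq> 0"
    using bspec[OF b(2) one_mem] zero_nonunits by auto
  moreover have "x = 0 \<and> y = 0 \<and> z = 0" if "cubic_norm b x y z = 0" for x y z
  proof (rule ccontr)
    assume "\<not> ?thesis"
    then have "(x, y, z) \<noteq> (0, 0, 0)" by simp
    then obtain u w where "cubic_norm b x y z = u * w ^ 3" "w \<noteq> 0" "u \<in> R" "u \<notin> nonunits"
      by (rule cubic_norm_eq_unit_cube[OF b])
    then show False using that zero_nonunits by auto
  qed
  \<comment> \<open>The witness is \<open>inverse d\<close>, because it is \<open>d\<close> that is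
    not a norm.\<close>
  moreover have "inverse d * cubic_norm b x y z \<noteq> 1" for x y z
  proof
    assume *: "inverse d * cubic_norm b x y z = 1"
    then have eq: "cubic_norm b x y z = d" using d(1) by (simp add: field_simps)
    have "(x, y, z) \<noteq> (0, 0, 0)"
      using eq d(1) by (auto simp: cubic_norm_def)
    then obtain u w where "cubic_norm b x y z = u * w ^ 3" "w \<noteq> 0" "u \<in> R" "u \<notin> nonunits"
      by (rule cubic_norm_eq_unit_cube[OF b])
    then show False using d(2) eq by auto
  qed
  moreover have "inverse d \<noteq> 0" using d(1) by simp
  ultimately show ?thesis by blast
qed

end

lemma number_field_exists_cubic_norm:
  assumes "number_field TYPE('k::field_char_0)"
  shows "\<exists>b d :: 'k. b \<noteq> 0 \<and> d \<noteq> 0 \<and>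
    (\<forall>x y z. cubic_norm b x y z = 0 \<longrightarrow> x = 0 \<and> y = 0 \<and> z = 0) \<and>
    (\<forall>x y z. d * cubic_norm b x y z \<noteq> 1)"
proof -
  obtain B :: "'k set" where B: "finite B" "module.span rat_scale B = UNIV"
    using assms unfolding number_field_def by blast
  obtain R :: "'k set" where R: "valuation_subring R" "inverse 2 \<notin> R"
    using exists_valuation_subring_half by blast
  interpret dyadic_valuation R B
    using R B by (simp add: dyadic_valuation_def dyadic_valuation_axioms_def)
  show ?thesis by (rule exists_cubic_norm)
qed

subsection \<open>Split octonions\<close>

lemma linearI':
  assumes "vector_space s" "\<And>x y. f (x + y) = f x + f y" "\<And>a x. f (s a x) = s a (f x)"
  shows "Vector_Spaces.linear s s f"
  using assms by (simp add: Vector_Spaces.linear_iff)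

section \<open>A criterion for semisimplicity\<close>

context vector_space
begin

text \<open>Going through the family, each member not contained in the current subspace meets it
  trivially and is added to it. The members added sum to a complement.\<close>

lemma semisimple_mapI:
  assumes lin: "Vector_Spaces.linear scale scale f"
    and fin: "finite \<S>"
    and inv: "\<And>S. S \<in> \<S> \<Longrightarrow> subspace S \<and> f ` S \<subseteq> S"
    and simple: "\<And>S U. S \<in> \<S> \<Longrightarrow> subspace U \<Longrightarrow> f ` U \<subseteq> U \<Longrightarrow> U \<inter> S \<subseteq> {0} \<or> S \<subseteq> U"
    and span: "span (\<Union>\<S>) = UNIV"
  shows "semisimple_map scale f"
proof -
  interpret f: Vector_Spaces.linear scale scale f by (rule lin)
  have complement: "\<exists>W. subspace W \<and> f ` W \<subseteq> W \<and> U \<inter> W = {0} \<and> (\<forall>v. \<exists>u\<in>U. \<exists>w\<in>W. v = u + w)"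
    if "finite \<T>" "\<T> \<subseteq> \<S>" "subspace U" "f ` U \<subseteq> U" "span (U \<union> \<Union>\<T>) = UNIV" for \<T> U
    using that
  proof (induction \<T> arbitrary: U rule: finite_induct)
    case empty
    then have "U = UNIV" by (simp add: span_eq_iff[THEN iffD2])
    then show ?case
      by (intro exI[of _ "{0}"]) (auto simp: subspace_0)
  next
    case (insert S \<T>)
    have S: "subspace S" "f ` S \<subseteq> S" using inv insert.prems by auto
    show ?case
    proof (cases "S \<subseteq> U")
      case True
      then have "U \<union> \<Union>(insert S \<T>) = U \<union> \<Union>\<T>" by auto
      then show ?thesis using insert.IH[of U] insert.prems by simp
    next
      case False
      then have disj: "U \<inter> S \<subseteq> {0}" using simple[of S U] insert.prems by auto
      \<comment> \<open>If \<open>W'\<close> is a complement of U + S, then S + W' is one of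
        \<open>U\<close>.\<close>
      define U' where "U' = {x + y |x y. x \<in> U \<and> y \<in> S}"
      have U'I: "x + y \<in> U'" if "x \<in> U" "y \<in> S" for x y
        using that unfolding U'_def by blast
      have "U \<subseteq> U'" using U'I[OF _ subspace_0[OF S(1)]] by auto
      moreover have "S \<subseteq> U'" using U'I[OF subspace_0[OF insert.prems(2)]] by auto
      ultimately have "U \<union> \<Union>(insert S \<T>) \<subseteq> U' \<union> \<Union>\<T>" by auto
      then have "span (U' \<union> \<Union>\<T>) = UNIV" using insert.prems(4) span_mono by blast
      moreover have "subspace U'"
        unfolding U'_def by (rule subspace_sums[OF insert.prems(2) S(1)])
      moreover have "f ` U' \<subseteq> U'"
        using insert.prems(3) S(2) by (auto simp: U'_def f.add) blast
      ultimately obtain W' where W': "subspace W'" "f ` W' \<subseteq> W'" "U' \<inter> W' = {0}"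
          "\<forall>v. \<exists>u\<in>U'. \<exists>w\<in>W'. v = u + w"
        using insert.IH[of U'] insert.prems by auto
      define W where "W = {x + y |x y. x \<in> S \<and> y \<in> W'}"
      have "subspace W"
        unfolding W_def by (rule subspace_sums[OF S(1) W'(1)])
      moreover have "f ` W \<subseteq> W"
        using W'(2) S(2) by (auto simp: W_def f.add) blast
      moreover have "U \<inter> W \<subseteq> {0}"
      proof
        fix u assume "u \<in> U \<inter> W"
        then obtain x y where u: "u \<in> U" "u = x + y" "x \<in> S" "y \<in> W'"
          unfolding W_def by blast
        have "y = u + - x" using u by simp
        also have "\<dots> \<in> U'" by (rule U'I[OF u(1) subspace_neg[OF S(1) u(3)]])
        finally have "y = 0" using W'(3) u by blast
        then have "u \<in> U \<inter> S" using u by simp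
        then show "u \<in> {0}" using disj by blast
      qed
      moreover have "0 \<in> U \<inter> W" using subspace_0 \<open>subspace W\<close> insert.prems by auto
      moreover have "\<exists>u\<in>U. \<exists>w\<in>W. v = u + w" for v
      proof -
        obtain u' w where "u' \<in> U'" "w \<in> W'" "v = u' + w" using W'(4) by blast
        moreover from this obtain x y where "x \<in> U" "y \<in> S" "u' = x + y"
          unfolding U'_def by blast
        ultimately have "x \<in> U" "y + w \<in> W" "v = x + (y + w)"
          unfolding W_def by (auto simp: add.assoc)
        then show ?thesis by blast
      qed
      ultimately show ?thesis by blast
    qed
  qed
  have "span (U \<union> \<Union>\<S>) = UNIV" for U
    using span span_mono[of "\<Union>\<S>" "U \<union> \<Union>\<S>"] by auto
  then show ?thesis
    unfolding semisimple_map_def using lin complement[OF fin order_refl] by simp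
qed

end

section \<open>Coordinates in dimension eight\<close>

lemma exhaust_8:
  fixes x :: 8
  shows "x = 1 \<or> x = 2 \<or> x = 3 \<or> x = 4 \<or> x = 5 \<or> x = 6 \<or> x = 7 \<or> x = 8"
proof (induct x)
  case (of_int z)
  then have "z = 0 \<or> z = 1 \<or> z = 2 \<or> z = 3 \<or> z = 4 \<or> z = 5 \<or> z = 6 \<or> z = 7" by fastforce
  then show ?case by auto
qed

lemma forall_8: "(\<forall>i::8. P i) \<longleftrightarrow> P 1 \<and> P 2 \<and> P 3 \<and> P 4 \<and> P 5 \<and> P 6 \<and> P 7 \<and> P 8"
  by (metis exhaust_8)

lemma vector_8 [simp]:
  "(vector [a, u1, u2, u3, v1, v2, v3, c] :: ('a::zero)^8) $ 1 = a"
  "(vector [a, u1, u2, u3, v1, v2, v3, c] :: ('a::zero)^8) $ 2 = u1"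
  "(vector [a, u1, u2, u3, v1, v2, v3, c] :: ('a::zero)^8) $ 3 = u2"
  "(vector [a, u1, u2, u3, v1, v2, v3, c] :: ('a::zero)^8) $ 4 = u3"
  "(vector [a, u1, u2, u3, v1, v2, v3, c] :: ('a::zero)^8) $ 5 = v1"
  "(vector [a, u1, u2, u3, v1, v2, v3, c] :: ('a::zero)^8) $ 6 = v2"
  "(vector [a, u1, u2, u3, v1, v2, v3, c] :: ('a::zero)^8) $ 7 = v3"
  "(vector [a, u1, u2, u3, v1, v2, v3, c] :: ('a::zero)^8) $ 8 = c"
  unfolding vector_def by simp_all

lemma vec8_eq_iff:
  "(x :: 'a^8) = y \<longleftrightarrow> x$1 = y$1 \<and> x$2 = y$2 \<and> x$3 = y$3 \<and> x$4 = y$4 \<and>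
     x$5 = y$5 \<and> x$6 = y$6 \<and> x$7 = y$7 \<and> x$8 = y$8"
  by (simp add: vec_eq_iff forall_8)

text \<open>Zorn's vector matrices: coordinates 1 and 8 form the diagonal, coordinates 2--4 and 5--7
  are the two off-diagonal vectors.\<close>

definition zorn_mult :: "'k::field ^ 8 \<Rightarrow> 'k ^ 8 \<Rightarrow> 'k ^ 8" where
  "zorn_mult x y = vector
    [x$1 * y$1 + x$2 * y$5 + x$3 * y$6 + x$4 * y$7,
     x$1 * y$2 + x$2 * y$8 - (x$6 * y$7 - x$7 * y$6),
     x$1 * y$3 + x$3 * y$8 - (x$7 * y$5 - x$5 * y$7),
     x$1 * y$4 + x$4 * y$8 - (x$5 * y$6 - x$6 * y$5),
     x$5 * y$1 + x$8 * y$5 + (x$3 * y$4 - x$4 * y$3),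
     x$6 * y$1 + x$8 * y$6 + (x$4 * y$2 - x$2 * y$4),
     x$7 * y$1 + x$8 * y$7 + (x$2 * y$3 - x$3 * y$2),
     x$8 * y$8 + x$5 * y$2 + x$6 * y$3 + x$7 * y$4]"

definition zorn_one :: "'k::field ^ 8" where
  "zorn_one = vector [1, 0, 0, 0, 0, 0, 0, 1]"

text \<open>The determinant of a vector matrix, an orthogonal sum of four hyperbolic planes.\<close>

definition zorn_norm :: "'k::field ^ 8 \<Rightarrow> 'k" where
  "zorn_norm x = x$1 * x$8 - x$2 * x$5 - x$3 * x$6 - x$4 * x$7"

lemma polar_zorn_norm:
  "polar_form zorn_norm x y =
     x$1 * y$8 + x$8 * y$1 - x$2 * y$5 - x$5 * y$2 - x$3 * y$6 - x$6 * y$3 - x$4 * y$7 - x$7 * y$4"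
  unfolding polar_form_def zorn_norm_def by (simp add: algebra_simps)

lemma zorn_norm_mult: "zorn_norm (zorn_mult x y) = zorn_norm x * zorn_norm y"
  unfolding zorn_norm_def zorn_mult_def vector_8 by algebra

lemma nondegenerate_zorn_norm: "nondegenerate_quadratic_form (*s) (zorn_norm :: 'k::field ^ 8 \<Rightarrow> 'k)"
  unfolding nondegenerate_quadratic_form_def
proof (intro conjI allI impI)
  fix a and x :: "'k ^ 8"
  show "zorn_norm (a *s x) = a\<^sup>2 * zorn_norm x"
    by (simp add: zorn_norm_def algebra_simps power2_eq_square)
  have "vector_space ((*) :: 'k \<Rightarrow> 'k \<Rightarrow> 'k)"
    by (rule vector_space_over_itself.vector_space_axioms)
  then show "Vector_Spaces.linear (*s) (*) (polar_form zorn_norm x)"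
    "Vector_Spaces.linear (*s) (*) (\<lambda>y. polar_form zorn_norm y x)"
    by (simp_all add: Vector_Spaces.linear_iff vec.vector_space_axioms polar_zorn_norm algebra_simps)
next
  fix x :: "'k ^ 8"
  assume *: "\<forall>y. polar_form zorn_norm x y = 0"
  have "x $ i = 0" for i
    \<comment> \<open>Pairing with the basis vectors returns every coordinate up to sign.\<close>
    using *[rule_format, of "axis 1 1"] *[rule_format, of "axis 2 1"]
      *[rule_format, of "axis 3 1"] *[rule_format, of "axis 4 1"]
      *[rule_format, of "axis 5 1"] *[rule_format, of "axis 6 1"]
      *[rule_format, of "axis 7 1"] *[rule_format, of "axis 8 1"] exhaust_8[of i]
    by (auto simp: polar_zorn_norm axis_def)
  then show "x = 0" by (simp add: vec_eq_iff)
qed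

lemma zorn_mult_one: "zorn_mult zorn_one x = x" "zorn_mult x zorn_one = x"
  by (simp_all add: vec8_eq_iff zorn_mult_def zorn_one_def)

lemma octonion_algebra_zorn:
  "octonion_algebra (*s) (zorn_mult :: 'k::field ^ 8 \<Rightarrow> _) zorn_one zorn_norm"
proof (intro octonion_algebra.intro octonion_algebra_axioms.intro vec.vector_space_axioms)
  show "vec.dim (UNIV :: ('k ^ 8) set) = 8"
    unfolding vec_dim_card by simp
  fix x y :: "'k ^ 8"
  show "Vector_Spaces.linear (*s) (*s) (zorn_mult x)"
    "Vector_Spaces.linear (*s) (*s) (\<lambda>x. zorn_mult x y)"
    by (rule linearI'[OF vec.vector_space_axioms];
        simp add: vec8_eq_iff zorn_mult_def algebra_simps)+
  show "zorn_mult zorn_one x = x" "zorn_mult x zorn_one = x"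
    by (rule zorn_mult_one)+
qed (rule nondegenerate_zorn_norm zorn_norm_mult)+

subsection \<open>A non-real semisimple automorphism\<close>

fun det3 :: "'k::comm_ring_1 \<times> 'k \<times> 'k \<Rightarrow> 'k \<times> 'k \<times> 'k \<Rightarrow> 'k \<times> 'k \<times> 'k \<Rightarrow> 'k" where
  "det3 (p1, p2, p3) (q1, q2, q3) (r1, r2, r3) =
     p1 * (q2 * r3 - q3 * r2) - p2 * (q1 * r3 - q3 * r1) + p3 * (q1 * r2 - q2 * r1)"

lemma cramer3:
  assumes "det3 (p1, p2, p3) (q1, q2, q3) (r1, r2, r3) = (D :: 'k::field)" "D \<noteq> 0"
  shows "\<exists>\<alpha> \<beta> \<gamma>. y1 = \<alpha> * p1 + \<beta> * q1 + \<gamma> * r1 \<and> y2 = \<alpha> * p2 + \<beta> * q2 + \<gamma> * r2 \<and>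
    y3 = \<alpha> * p3 + \<beta> * q3 + \<gamma> * r3"
proof -
  define j where "j = inverse D"
  have j: "j * det3 (p1, p2, p3) (q1, q2, q3) (r1, r2, r3) = 1"
    using assms by (simp add: j_def)
  show ?thesis
    by (intro exI[of _ "j * det3 (y1, y2, y3) (q1, q2, q3) (r1, r2, r3)"]
        exI[of _ "j * det3 (p1, p2, p3) (y1, y2, y3) (r1, r2, r3)"]
        exI[of _ "j * det3 (p1, p2, p3) (q1, q2, q3) (y1, y2, y3)"] conjI;
        use j in \<open>unfold det3.simps, algebra\<close>)
qed

definition upper :: "'k ^ 8 \<Rightarrow> 'k \<times> 'k \<times> 'k" where
  "upper x = (x$2, x$3, x$4)"

definition lower :: "'k ^ 8 \<Rightarrow> 'k \<times> 'k \<times> 'k" where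
  "lower x = (x$5, x$6, x$7)"

lemma axis_8_nth: "(axis i c :: 'k::zero ^ 8) $ j = (if j = i then c else 0)"
  by (simp add: axis_def)

text \<open>The inverse of \<open>d\<close> is a parameter so that the identities below follow from
  \<open>i * d = 1\<close> by polynomial algebra. \<open>anisotropic\<close> excludes roots of X^3 +
  bX - 1, and \<open>not_norm\<close> says that \<open>i\<close> is not a norm.\<close>

locale zorn_torus =
  fixes b d i :: "'k::field"
  assumes b_nonzero: "b \<noteq> 0"
    and inverse_d: "i * d = 1"
    and anisotropic: "cubic_norm b x y z = 0 \<Longrightarrow> x = 0 \<and> y = 0 \<and> z = 0"
    and not_norm: "d * cubic_norm b x y z \<noteq> 1"
begin

text \<open>With \<open>C\<close> the companion matrix of \<open>X\<^sup>3 + bX - 1\<close>, \<open>P = diag(d, 1, 1)\<close> and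
  \<open>A = P C P\<^sup>-\<^sup>1\<close>, this is \<open>A\<close> on the upper vector and its inverse transpose on the lower one.\<close>

definition torus_map :: "'k ^ 8 \<Rightarrow> 'k ^ 8" where
  "torus_map x = vector
    [x$1, d * x$4, i * x$2 - b * x$4, x$3, i * x$7 + b * x$5, d * x$5, x$6, x$8]"

definition torus_inv :: "'k ^ 8 \<Rightarrow> 'k ^ 8" where
  "torus_inv x = vector
    [x$1, d * x$3 + b * x$2, x$4, i * x$2, i * x$6, x$7, d * x$5 - b * x$6, x$8]"

lemma torus_map_nth:
  "torus_map x $ 1 = x$1" "torus_map x $ 2 = d * x$4" "torus_map x $ 3 = i * x$2 - b * x$4"
  "torus_map x $ 4 = x$3" "torus_map x $ 5 = i * x$7 + b * x$5" "torus_map x $ 6 = d * x$5"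
  "torus_map x $ 7 = x$6" "torus_map x $ 8 = x$8"
  by (simp_all add: torus_map_def)

lemma cancel: "d * i = 1" "i * (d * z) = z" "d * (i * z) = z"
  using inverse_d by (simp_all add: mult.commute flip: mult.assoc)

lemma d_nonzero: "d \<noteq> 0" and i_nonzero: "i \<noteq> 0"
  using inverse_d by auto

lemma linear_torus_map: "Vector_Spaces.linear (*s) (*s) torus_map"
  by (rule linearI'[OF vec.vector_space_axioms])
    (simp_all add: vec8_eq_iff torus_map_nth algebra_simps)

lemma torus_map_inv: "torus_map (torus_inv x) = x"
  unfolding vec8_eq_iff torus_map_def torus_inv_def vector_8
  by (intro conjI; (rule refl | use inverse_d in algebra))

lemma torus_inv_map: "torus_inv (torus_map x) = x"
  unfolding vec8_eq_iff torus_map_def torus_inv_def vector_8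
  by (intro conjI; (rule refl | use inverse_d in algebra))

lemma bij_torus_map: "bij torus_map"
  by (rule o_bij[of torus_inv]) (auto simp: torus_map_inv torus_inv_map)

text \<open>Since \<open>A\<close> has determinant 1, it is compatible with its inverse transpose
  under cross products; dot products of upper with lower vectors are preserved.\<close>

lemma torus_map_mult: "torus_map (zorn_mult x y) = zorn_mult (torus_map x) (torus_map y)"
  by (simp add: vec8_eq_iff torus_map_nth zorn_mult_def algebra_simps cancel)

lemma torus_map_Aut: "torus_map \<in> algebra_Aut (*s) zorn_mult"
  unfolding algebra_Aut_def using linear_torus_map bij_torus_map torus_map_mult by blast

text \<open>The characteristic polynomial of \<open>A\<close> takes the value \<open>b\<close> at 1,
  so neither \<open>A\<close> nor its inverse transpose has a nonzero fixed vector.\<close>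

lemma torus_map_fixed:
  assumes "torus_map x = x"
  shows "x$2 = 0 \<and> x$3 = 0 \<and> x$4 = 0 \<and> x$5 = 0 \<and> x$6 = 0 \<and> x$7 = 0"
proof -
  have eq: "d * x$4 = x$2" "i * x$2 - b * x$4 = x$3" "x$3 = x$4"
    "i * x$7 + b * x$5 = x$5" "d * x$5 = x$6" "x$6 = x$7"
    using assms unfolding vec8_eq_iff torus_map_nth by auto
  have "i * x$2 = x$4" "i * x$7 = x$5"
    by (simp_all add: cancel flip: eq(1,5,6))
  then have "b * x$4 = 0" "b * x$5 = 0"
    using eq(2-4) by simp_all
  then show ?thesis using eq b_nonzero by auto
qed

text \<open>Up to conjugation by \<open>P\<close>, \<open>A\<close> is multiplication by \<theta> in
  the basis 1, \<theta>, \<theta>^2, and v, \<theta>v, \<theta>^2 v have the norm of v as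
  determinant. The factor \<open>d\<close> is det P.\<close>

lemma det3_upper:
  "det3 (upper x) (upper (torus_map x)) (upper (torus_map (torus_map x))) =
     d * cubic_norm b (i * x$2) (x$3) (x$4)"
proof -
  have "det3 (x, y, z) (d * z, i * x - b * z, y) (d * y, i * (d * z) - b * y, i * x - b * z) =
      d * cubic_norm b (i * x) y z" for x y z
    unfolding det3.simps cubic_norm_def using inverse_d by algebra
  then show ?thesis by (simp only: upper_def torus_map_nth)
qed

text \<open>In the coordinates on the right the lower block is multiplication by the inverse of
  \<theta>, which is \<theta>^2 + b.\<close>

lemma det3_lower:
  "det3 (lower x) (lower (torus_map x)) (lower (torus_map (torus_map x))) =
     i * cubic_norm b (x$7 + b * d * x$5) (x$6) (d * x$5)"
proof -
  have "det3 (x, y, z) (i * z + b * x, d * x, y)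
      (i * y + b * (i * z + b * x), d * (i * z + b * x), d * x) =
      i * cubic_norm b (z + b * d * x) y (d * x)" for x y z
    unfolding det3.simps cubic_norm_def using inverse_d by algebra
  then show ?thesis by (simp only: lower_def torus_map_nth)
qed

lemma det3_upper_nonzero:
  assumes "upper x \<noteq> (0, 0, 0)"
  shows "det3 (upper x) (upper (torus_map x)) (upper (torus_map (torus_map x))) \<noteq> 0"
  unfolding det3_upper using anisotropic[of "i * x$2" "x$3" "x$4"] assms d_nonzero i_nonzero
  by (auto simp: upper_def)

lemma det3_lower_nonzero:
  assumes "lower x \<noteq> (0, 0, 0)"
  shows "det3 (lower x) (lower (torus_map x)) (lower (torus_map (torus_map x))) \<noteq> 0"
  unfolding det3_lower using anisotropic[of "x$7 + b * d * x$5" "x$6" "d * x$5"]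
    assms d_nonzero i_nonzero
  by (auto simp: lower_def)

section \<open>Stable blocks and semisimplicity\<close>

definition corner1 :: "('k ^ 8) set" where
  "corner1 = {x. upper x = (0, 0, 0) \<and> lower x = (0, 0, 0) \<and> x$8 = 0}"

definition corner8 :: "('k ^ 8) set" where
  "corner8 = {x. upper x = (0, 0, 0) \<and> lower x = (0, 0, 0) \<and> x$1 = 0}"

definition uppers :: "('k ^ 8) set" where
  "uppers = {x. x$1 = 0 \<and> lower x = (0, 0, 0) \<and> x$8 = 0}"

definition lowers :: "('k ^ 8) set" where
  "lowers = {x. x$1 = 0 \<and> upper x = (0, 0, 0) \<and> x$8 = 0}"

lemmas block_defs = corner1_def corner8_def uppers_def lowers_def upper_def lower_def

lemma krylov_combination:
  assumes U: "vec.subspace U" "torus_map ` U \<subseteq> U" and x: "x \<in> U"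
  shows "\<alpha> *s x + \<beta> *s torus_map x + \<gamma> *s torus_map (torus_map x) \<in> U"
proof -
  have "torus_map x \<in> U" "torus_map (torus_map x) \<in> U" using U(2) x by blast+
  then show ?thesis
    using x by (intro vec.subspace_add[OF U(1)] vec.subspace_scale[OF U(1)])
qed

text \<open>A nonzero upper vector and its first two images form a basis of the block, since their
  determinant is \<open>d\<close> times a nonzero norm.\<close>

lemma uppers_simple:
  assumes U: "vec.subspace U" "torus_map ` U \<subseteq> U"
  shows "U \<inter> uppers \<subseteq> {0} \<or> uppers \<subseteq> U"
proof (rule disjCI)
  assume "\<not> uppers \<subseteq> U"
  have "uppers \<subseteq> U" if x: "x \<in> U" "x \<in> uppers" "x \<noteq> 0" for x
  proof
    fix y assume y: "y \<in> uppers"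
    have "upper x \<noteq> (0, 0, 0)"
      using x by (auto simp: block_defs vec8_eq_iff)
    then obtain \<alpha> \<beta> \<gamma> where abc:
      "y$2 = \<alpha> * x$2 + \<beta> * torus_map x$2 + \<gamma> * torus_map (torus_map x)$2"
      "y$3 = \<alpha> * x$3 + \<beta> * torus_map x$3 + \<gamma> * torus_map (torus_map x)$3"
      "y$4 = \<alpha> * x$4 + \<beta> * torus_map x$4 + \<gamma> * torus_map (torus_map x)$4"
      using cramer3[OF refl det3_upper_nonzero[unfolded upper_def]] unfolding upper_def by blast
    have "y = \<alpha> *s x + \<beta> *s torus_map x + \<gamma> *s torus_map (torus_map x)"
      using abc x(2) y by (simp add: vec8_eq_iff block_defs torus_map_nth)
    then show "y \<in> U" using krylov_combination[OF U x(1)] by simp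
  qed
  then show "U \<inter> uppers \<subseteq> {0}" using \<open>\<not> uppers \<subseteq> U\<close> by blast
qed

lemma lowers_simple:
  assumes U: "vec.subspace U" "torus_map ` U \<subseteq> U"
  shows "U \<inter> lowers \<subseteq> {0} \<or> lowers \<subseteq> U"
proof (rule disjCI)
  assume "\<not> lowers \<subseteq> U"
  have "lowers \<subseteq> U" if x: "x \<in> U" "x \<in> lowers" "x \<noteq> 0" for x
  proof
    fix y assume y: "y \<in> lowers"
    have "lower x \<noteq> (0, 0, 0)"
      using x by (auto simp: block_defs vec8_eq_iff)
    then obtain \<alpha> \<beta> \<gamma> where abc:
      "y$5 = \<alpha> * x$5 + \<beta> * torus_map x$5 + \<gamma> * torus_map (torus_map x)$5"
      "y$6 = \<alpha> * x$6 + \<beta> * torus_map x$6 + \<gamma> * torus_map (torus_map x)$6"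
      "y$7 = \<alpha> * x$7 + \<beta> * torus_map x$7 + \<gamma> * torus_map (torus_map x)$7"
      using cramer3[OF refl det3_lower_nonzero[unfolded lower_def]] unfolding lower_def by blast
    have "y = \<alpha> *s x + \<beta> *s torus_map x + \<gamma> *s torus_map (torus_map x)"
      using abc x(2) y by (simp add: vec8_eq_iff block_defs torus_map_nth)
    then show "y \<in> U" using krylov_combination[OF U x(1)] by simp
  qed
  then show "U \<inter> lowers \<subseteq> {0}" using \<open>\<not> lowers \<subseteq> U\<close> by blast
qed

lemma corners_simple:
  assumes U: "vec.subspace U"
  shows "U \<inter> corner1 \<subseteq> {0} \<or> corner1 \<subseteq> U" "U \<inter> corner8 \<subseteq> {0} \<or> corner8 \<subseteq> U"
proof -
  have "y \<in> U" if "x \<in> U" "x \<in> corner1" "x \<noteq> 0" "y \<in> corner1" for x y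
  proof -
    have "y = (y$1 / x$1) *s x"
      using that by (auto simp: vec8_eq_iff block_defs)
    then show ?thesis using vec.subspace_scale[OF U that(1)] by metis
  qed
  then show "U \<inter> corner1 \<subseteq> {0} \<or> corner1 \<subseteq> U" by blast
  have "y \<in> U" if "x \<in> U" "x \<in> corner8" "x \<noteq> 0" "y \<in> corner8" for x y
  proof -
    have "y = (y$8 / x$8) *s x"
      using that by (auto simp: vec8_eq_iff block_defs)
    then show ?thesis using vec.subspace_scale[OF U that(1)] by metis
  qed
  then show "U \<inter> corner8 \<subseteq> {0} \<or> corner8 \<subseteq> U" by blast
qed

lemma semisimple_torus_map: "semisimple_map (*s) torus_map"
proof (rule vec.semisimple_mapI[OF linear_torus_map, of "{corner1, corner8, uppers, lowers}"])
  show "vec.subspace S \<and> torus_map ` S \<subseteq> S" if "S \<in> {corner1, corner8, uppers, lowers}" for S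
    using that by (auto simp: block_defs vec.subspace_def torus_map_nth)
  show "U \<inter> S \<subseteq> {0} \<or> S \<subseteq> U"
    if "S \<in> {corner1, corner8, uppers, lowers}" "vec.subspace U" "torus_map ` U \<subseteq> U" for S U
    using that(1) uppers_simple[OF that(2,3)] lowers_simple[OF that(2,3)] corners_simple[OF that(2)]
    by (elim insertE emptyE) simp_all
  define T where "T = vec.span (\<Union>{corner1, corner8, uppers, lowers})"
  have T: "x \<in> T" if "x \<in> corner1 \<or> x \<in> corner8 \<or> x \<in> uppers \<or> x \<in> lowers" for x
    unfolding T_def using that by (intro vec.span_base) auto
  have "x \<in> T" for x
  proof -
    have "x = vector [x$1, 0, 0, 0, 0, 0, 0, 0] + vector [0, 0, 0, 0, 0, 0, 0, x$8]
        + vector [0, x$2, x$3, x$4, 0, 0, 0, 0] + vector [0, 0, 0, 0, x$5, x$6, x$7, 0]"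
      by (simp add: vec8_eq_iff)
    also have "\<dots> \<in> T"
      unfolding T_def
      by (intro vec.span_add; fold T_def; intro T) (simp_all add: block_defs)
    finally show ?thesis .
  qed
  then show "vec.span (\<Union>{corner1, corner8, uppers, lowers}) = UNIV"
    unfolding T_def by blast
qed simp

section \<open>No automorphism reverses the torus element\<close>

lemma not_reversed:
  assumes g: "g \<in> algebra_Aut (*s) zorn_mult" and rev: "\<And>x. torus_map (g (torus_map x)) = g x"
  shows False
proof -
  have lin: "Vector_Spaces.linear (*s) (*s) g" and bij: "bij g"
    and mult: "\<And>x y. g (zorn_mult x y) = zorn_mult (g x) (g y)"
    using g by (auto simp: algebra_Aut_def)
  interpret g: Vector_Spaces.linear "(*s)" "(*s)" g by (rule lin)
  have inj: "g x = g y \<Longrightarrow> x = y" for x y using bij by (meson bij_def injD)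
  have g0: "g x = 0 \<Longrightarrow> x = 0" for x using inj[of x 0] by simp
  define X where "X j = (axis j 1 :: 'k ^ 8)" for j
  note X = X_def axis_8_nth
  have one: "g zorn_one = zorn_one"
  proof -
    obtain y where y: "g y = zorn_one" using bij by (metis bij_pointE)
    have "zorn_mult (g zorn_one) (g y) = g y"
      unfolding mult[symmetric] zorn_mult_one ..
    then show ?thesis unfolding y zorn_mult_one .
  qed
  \<comment> \<open>The image of the idempotent \<open>X 1\<close> is again fixed by
    \<open>torus_map\<close>, hence diagonal; being an idempotent other than 0 and 1, it is
    \<open>X 1\<close> or \<open>X 8\<close>.\<close>
  have "torus_map (X 1) = X 1" by (simp add: vec8_eq_iff torus_map_nth X)
  then have "torus_map (g (X 1)) = g (X 1)" using rev[of "X 1"] by simp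
  then have off: "g (X 1)$2 = 0 \<and> g (X 1)$3 = 0 \<and> g (X 1)$4 = 0 \<and> g (X 1)$5 = 0 \<and>
      g (X 1)$6 = 0 \<and> g (X 1)$7 = 0"
    by (rule torus_map_fixed)
  have "zorn_mult (X 1) (X 1) = X 1" by (simp add: vec8_eq_iff zorn_mult_def X)
  then have "zorn_mult (g (X 1)) (g (X 1)) = g (X 1)" using mult by metis
  then have idem: "g (X 1)$1 * g (X 1)$1 = g (X 1)$1" "g (X 1)$8 * g (X 1)$8 = g (X 1)$8"
    using off by (simp_all add: vec8_eq_iff zorn_mult_def)
  have "g (X 1) \<noteq> 0" using g0[of "X 1"] by (auto simp: vec8_eq_iff X)
  moreover have "g (X 1) \<noteq> zorn_one"
    using inj[of "X 1" zorn_one] one by (auto simp: vec8_eq_iff X zorn_one_def)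
  ultimately have cases: "g (X 1) = X 1 \<or> g (X 1) = X 8"
    using idem off by (auto simp: vec8_eq_iff X zorn_one_def)
  have "X 8 = zorn_one - X 1" by (simp add: vec8_eq_iff X zorn_one_def)
  then have g8: "g (X 8) = zorn_one - g (X 1)" by (simp add: g.diff one)
  have tX: "torus_map (X 2) = i *s X 3" "torus_map (X 3) = X 4"
    "torus_map (X 4) = d *s X 2 - b *s X 3"
    by (simp_all add: vec8_eq_iff torus_map_nth X)
  define p q r where "p = g (X 2)" and "q = g (X 3)" and "r = g (X 4)"
  have rels: "torus_map (i *s q) = p" "torus_map r = q" "torus_map (d *s p - b *s q) = r"
    using rev[of "X 2"] rev[of "X 3"] rev[of "X 4"]
    by (simp_all add: tX g.scale g.diff p_def q_def r_def)
  have "p$k = torus_map (i *s q)$k" "q$k = torus_map r$k" "r$k = torus_map (d *s p - b *s q)$k"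
    for k
    by (simp_all only: rels)
  \<comment> \<open>Each coordinate contributes three equations, for \<open>p\<close>,
    \<open>q\<close> and \<open>r\<close> in this order: 1 to 9 concern the upper block, 10 to 18
    the lower one.\<close>
  note comps = this[of 2] this[of 3] this[of 4] this[of 5] this[of 6] this[of 7]
  note comps = comps[unfolded torus_map_nth vector_smult_component vector_minus_component]
  \<comment> \<open>Transported by \<open>g\<close>, these relations put \<open>p\<close>,
    \<open>q\<close>, \<open>r\<close> into the upper block if \<open>X 1\<close> is fixed and into
    the lower block if it goes to \<open>X 8\<close>.\<close>
  have peirce: "zorn_mult (X 1) (X j) = X j" "zorn_mult (X j) (X 1) = 0"
    if "j = 2 \<or> j = 3 \<or> j = 4" for j
    using that by (auto simp: vec8_eq_iff zorn_mult_def X)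
  have peirce_g: "zorn_mult (g (X 1)) (g (X j)) = g (X j)" "zorn_mult (g (X j)) (g (X 1)) = 0"
    if "j = 2 \<or> j = 3 \<or> j = 4" for j
    using peirce[OF that] by (simp_all flip: mult)
  from cases show False
  proof
    assume e: "g (X 1) = X 1"
    have "q$1 = 0 \<and> q$5 = 0 \<and> q$6 = 0 \<and> q$7 = 0 \<and> q$8 = 0"
      using peirce_g[of 3, unfolded e, folded q_def] by (simp add: vec8_eq_iff zorn_mult_def X)
    moreover have "upper q \<noteq> (0, 0, 0) \<longrightarrow> False"
    proof
      assume "upper q \<noteq> (0, 0, 0)"
      then have nz: "det3 (upper q) (upper (torus_map q)) (upper (torus_map (torus_map q))) \<noteq> 0"
        by (rule det3_upper_nonzero)
      \<comment> \<open>As \<open>g\<close> turns \<open>A\<close> into its inverse, both A^3 + bA -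
        1 and A^(-3) + bA^(-1) - 1 kill the upper vector of \<open>q\<close>. Eliminating A^3 leaves
        b(A^2 + A)q = 0, whose coordinates are the three equations below; so the last two rows are
        opposite.\<close>
      have "det3 (q2, q3, q4) (d * q4, i * q2 - b * q4, q3)
          (d * q3, i * (d * q4) - b * q3, i * q2 - b * q4) = 0"
        if "p2 = d * (i * q4)" "p3 = i * (i * q2) - b * (i * q4)" "p4 = i * q3"
          "q2 = d * r4" "q3 = i * r2 - b * r4" "q4 = r3"
          "r2 = d * (d * p4 - b * q4)" "r3 = i * (d * p2 - b * q2) - b * (d * p4 - b * q4)"
          "r4 = d * p3 - b * q3" for p2 p3 p4 q2 q3 q4 r2 r3 r4
      proof -
        have "b * (d * (q4 + q3)) = 0" using that inverse_d by algebra
        then have 1: "q4 = - q3"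
          using b_nonzero d_nonzero by (simp add: eq_neg_iff_add_eq_0)
        have "b * (q3 + (i * q2 - b * q4)) = 0" using that inverse_d by algebra
        then have 2: "i * q2 - b * q4 = - q3"
          using b_nonzero by (simp add: eq_neg_iff_add_eq_0 add.commute)
        have "b * ((i * q2 - b * q4) + (i * (d * q4) - b * q3)) = 0"
          using that inverse_d by algebra
        then have 3: "i * (d * q4) - b * q3 = q3"
          using b_nonzero by (simp add: 2)
        show ?thesis unfolding 3 unfolding 2 unfolding 1 det3.simps by algebra
      qed
      from this[OF comps(1,4,7,2,5,8,3,6,9)]
      have "det3 (upper q) (upper (torus_map q)) (upper (torus_map (torus_map q))) = 0"
        unfolding upper_def torus_map_nth .
      with nz show False by blast
    qed
    ultimately have "q = 0" by (auto simp: vec8_eq_iff upper_def)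
    then have "X 3 = 0" using g0 by (simp add: q_def)
    then show False by (simp add: vec8_eq_iff X)
  next
    assume e: "g (X 1) = X 8"
    have zeros: "p$1 = 0 \<and> p$2 = 0 \<and> p$3 = 0 \<and> p$4 = 0 \<and> p$8 = 0"
      "q$1 = 0 \<and> q$2 = 0 \<and> q$3 = 0 \<and> q$4 = 0 \<and> q$8 = 0"
      "r$1 = 0 \<and> r$2 = 0 \<and> r$3 = 0 \<and> r$4 = 0 \<and> r$8 = 0"
      using peirce_g[of 2, unfolded e, folded p_def] peirce_g[of 3, unfolded e, folded q_def]
        peirce_g[of 4, unfolded e, folded r_def]
      by (simp_all add: vec8_eq_iff zorn_mult_def X)
    \<comment> \<open>The image of this triple product is \<open>X 1\<close>, and the first
      coordinate of a triple product of lower vectors is minus their determinant.\<close>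
    have "zorn_mult (zorn_mult (X 2) (X 3)) (X 4) = X 8"
      by (simp add: vec8_eq_iff zorn_mult_def X)
    then have "zorn_mult (zorn_mult p q) r = g (X 8)"
      by (metis mult p_def q_def r_def)
    also have "\<dots> = X 1"
      unfolding g8 e by (simp add: vec8_eq_iff X zorn_one_def)
    finally have "zorn_mult (zorn_mult p q) r $ 1 = 1" by (simp add: X)
    then have det: "det3 (lower p) (lower q) (lower r) = -1"
      using zeros by (simp add: zorn_mult_def lower_def algebra_simps)
    \<comment> \<open>The relations make \<open>q\<close> and \<open>r\<close> equal to
      \<open>d\<close> times the images of \<open>p\<close> under the inverse map and its square. In
      the coordinates of \<open>det3_lower\<close> the inverse is multiplication by \<theta>, so the
      determinant is \<open>- d\<close> times the norm belonging to \<open>p\<close>.\<close>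
    have "d * cubic_norm b (p7 + b * d * p5) p6 (d * p5) = 1"
      if "det3 (p5, p6, p7) (q5, q6, q7) (r5, r6, r7) = -1"
        "p5 = i * (i * q7) + b * (i * q5)" "p6 = d * (i * q5)" "p7 = i * q6"
        "q5 = i * r7 + b * r5" "q6 = d * r5" "q7 = r6" for p5 p6 p7 q5 q6 q7 r5 r6 r7
    proof -
      have q: "q5 = p6" "q6 = d * p7" "q7 = d * (d * p5) - b * (d * p6)"
        using that(2-4) inverse_d by - (algebra+)
      have "d * r5 = d * p7" using q(2) that(6) by simp
      then have r5: "r5 = p7" using d_nonzero by simp
      have "r7 = d * (q5 - b * r5)" using that(5) by (simp add: cancel)
      then have r7: "r7 = d * p6 - b * (d * p7)" unfolding q(1) r5 by (simp add: algebra_simps)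
      show ?thesis
        using that(1) unfolding that(7)[symmetric] q r5 r7 det3.simps cubic_norm_def by algebra
    qed
    from this[OF det[unfolded lower_def] comps(10,13,16,11,14,17)]
    have "d * cubic_norm b (p$7 + b * d * p$5) (p$6) (d * p$5) = 1" .
    then show False using not_norm by blast
  qed
qed

lemma torus_map_not_real: "\<not> real_in (algebra_Aut (*s) zorn_mult) torus_map"
proof
  assume "real_in (algebra_Aut (*s) zorn_mult) torus_map"
  then obtain g where g: "g \<in> algebra_Aut (*s) zorn_mult" "g \<circ> torus_map \<circ> inv g = inv torus_map"
    unfolding real_in_def conjugate_in_def by blast
  have "bij g" using g(1) by (simp add: algebra_Aut_def)
  have "torus_map (g (torus_map x)) = g x" for x
  proof -
    have "g (torus_map x) = (g \<circ> torus_map \<circ> inv g) (g x)"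
      using \<open>bij g\<close> by (simp add: bij_is_inj)
    also have "\<dots> = inv torus_map (g x)" by (simp only: g(2))
    finally show ?thesis
      using bij_torus_map by (simp add: bij_is_surj surj_f_inv_f)
  qed
  then show False using not_reversed g(1) by blast
qed

end

theorem proposition6p4:
  assumes "number_field TYPE('k::field_char_0)"
  shows "\<exists>(mult :: 'k ^ 8 \<Rightarrow> 'k ^ 8 \<Rightarrow> 'k ^ 8) unit N.
           octonion_algebra (*s) mult unit N \<and>
           (\<exists>t \<in> algebra_Aut (*s) mult.
              semisimple_map (*s) t \<and> \<not> real_in (algebra_Aut (*s) mult) t)"
proof -
  obtain b d :: 'k where b: "b \<noteq> 0" and d: "d \<noteq> 0"
    and aniso: "\<forall>x y z. cubic_norm b x y z = 0 \<longrightarrow> x = 0 \<and> y = 0 \<and> z = 0"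
    and not_norm: "\<forall>x y z. d * cubic_norm b x y z \<noteq> 1"
    using number_field_exists_cubic_norm[OF assms] by blast
  have "zorn_torus b d (inverse d)"
  proof
    show "b \<noteq> 0" by (rule b)
    show "inverse d * d = 1" using d by simp
    fix x y z
    show "cubic_norm b x y z = 0 \<Longrightarrow> x = 0 \<and> y = 0 \<and> z = 0" using aniso by blast
    show "d * cubic_norm b x y z \<noteq> 1" using not_norm by blast
  qed
  then interpret zorn_torus b d "inverse d" .
  show ?thesis
    using octonion_algebra_zorn torus_map_Aut semisimple_torus_map torus_map_not_real by blast
qed

end
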